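(* Let $G=(V,E)$ be a connected (vertex-)transitive graph satisfying $c'r^{d'}\le|B(o,r)|\le c''r^{d''}$ for every $r\ge 1$ and every $o\in V$, for some $c',c''>0$ and $1<d'\le d''<\infty$. Then $p_c(G)<1$.
   Context: $B(o,r)$ is the set of vertices at graph distance at most $r$ from $o$. In Bernoulli (site) percolation each vertex is independently open with probability $p$ and closed otherwise; $\mathbb{G}_p$ is the random subgraph of $G$ induced by the open vertices, and $p_c(G)=\sup\{p\in[0,1]:\mathbb{P}[\text{there exists an infinite cluster (connected component) in }\mathbb{G}_p]=0\}$. *)

theory Defs
  imports "HOL-Probability.Probability"
begin

text \<open>A graph is given by its vertex set \<open>V\<close> and its set \<open>E\<close> of edges, which are two-element subsets of
  \<open>V\<close>. Neither has to be finite.\<close>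

definition simple_graph :: "'v set \<Rightarrow> 'v set set \<Rightarrow> bool" where
  "simple_graph V E \<longleftrightarrow> (\<forall>e\<in>E. \<exists>x\<in>V. \<exists>y\<in>V. x \<noteq> y \<and> e = {x, y})"

definition walk :: "'v set \<Rightarrow> 'v set set \<Rightarrow> 'v \<Rightarrow> 'v list \<Rightarrow> 'v \<Rightarrow> bool" where
  "walk V E x xs y \<longleftrightarrow> xs \<noteq> [] \<and> set xs \<subseteq> V \<and> hd xs = x \<and> last xs = y \<and>
     (\<forall>i. Suc i < length xs \<longrightarrow> {xs ! i, xs ! Suc i} \<in> E)"

text \<open>The length of a walk is its number of edges; the distance is \<open>\<infinity>\<close> if there is no walk.\<close>

definition graph_dist :: "'v set \<Rightarrow> 'v set set \<Rightarrow> 'v \<Rightarrow> 'v \<Rightarrow> enat" where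
  "graph_dist V E x y = Inf {enat (length xs - 1) | xs. walk V E x xs y}"

definition graph_ball :: "'v set \<Rightarrow> 'v set set \<Rightarrow> 'v \<Rightarrow> nat \<Rightarrow> 'v set" where
  "graph_ball V E x r = {y \<in> V. graph_dist V E x y \<le> enat r}"

text \<open>As usual, the graph without vertices does not count as connected.\<close>

definition connected_graph :: "'v set \<Rightarrow> 'v set set \<Rightarrow> bool" where
  "connected_graph V E \<longleftrightarrow> V \<noteq> {} \<and> (\<forall>x\<in>V. \<forall>y\<in>V. \<exists>xs. walk V E x xs y)"

definition graph_automorphism :: "'v set \<Rightarrow> 'v set set \<Rightarrow> ('v \<Rightarrow> 'v) \<Rightarrow> bool" where
  "graph_automorphism V E \<phi> \<longleftrightarrow> bij_betw \<phi> V V \<and>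
     (\<forall>x\<in>V. \<forall>y\<in>V. {\<phi> x, \<phi> y} \<in> E \<longleftrightarrow> {x, y} \<in> E)"

definition vertex_transitive :: "'v set \<Rightarrow> 'v set set \<Rightarrow> bool" where
  "vertex_transitive V E \<longleftrightarrow> (\<forall>x\<in>V. \<forall>y\<in>V. \<exists>\<phi>. graph_automorphism V E \<phi> \<and> \<phi> x = y)"

definition graph_components :: "'v set \<Rightarrow> 'v set set \<Rightarrow> 'v set set" where
  "graph_components V E = {{y \<in> V. \<exists>xs. walk V E x xs y} | x. x \<in> V}"

definition induced_edges :: "'v set set \<Rightarrow> 'v set \<Rightarrow> 'v set set" where
  "induced_edges E S = {e \<in> E. e \<subseteq> S}"

text \<open>A configuration \<open>\<omega>\<close> maps each vertex to \<open>True\<close> (open) or \<open>False\<close> (closed).\<close>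

definition open_vertices :: "'v set \<Rightarrow> ('v \<Rightarrow> bool) \<Rightarrow> 'v set" where
  "open_vertices V \<omega> = {x \<in> V. \<omega> x}"

definition clusters :: "'v set \<Rightarrow> 'v set set \<Rightarrow> ('v \<Rightarrow> bool) \<Rightarrow> 'v set set" where
  "clusters V E \<omega> = graph_components (open_vertices V \<omega>) (induced_edges E (open_vertices V \<omega>))"

definition site_percolation :: "'v set \<Rightarrow> real \<Rightarrow> ('v \<Rightarrow> bool) measure" where
  "site_percolation V p = (\<Pi>\<^sub>M x\<in>V. measure_pmf (bernoulli_pmf p))"

text \<open>The event below is measurable when \<open>V\<close> is countable, in particular for every connected, locally
  finite graph. (For non-measurable sets, \<open>measure\<close> would be the dummy value 0.)\<close>

definition critical_probability :: "'v set \<Rightarrow> 'v set set \<Rightarrow> real" where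
  "critical_probability V E = Sup {p \<in> {0..1}.
     measure (site_percolation V p)
       {\<omega> \<in> space (site_percolation V p). \<exists>C\<in>clusters V E \<omega>. infinite C} = 0}"

end

theory Submission
  imports Defs
begin

text \<open>A multiscale argument. Call a vertex good at scale \<open>L\<close> if the ball of radius of order \<open>L\<close>
  around it contains an open connection of length at least \<open>L\<close>, and any two such connections are joined
  by open paths close by. The main point is that few bad balls at scale \<open>L\<close> cannot prevent goodness at
  a much larger scale \<open>R\<close>. If the bad vertices near \<open>x\<close> are covered by \<open>J\<close> balls of radius of order
  \<open>L\<close>, then any two connections of length \<open>R\<close> contain vertices \<open>a\<close>, \<open>b\<close> whose balls of radius
  \<open>\<tau> = R / 8J\<close> avoid these balls. Send a unit of flow along uniformly random geodesics from each
  vertex of the first ball to each vertex of the second, \<open>(vol \<tau>)\<^sup>2\<close> units in total. By transitivity and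
  averaging, at most about \<open>R * vol R\<close> units pass through a given vertex if volumes are doubling at
  scale \<open>R\<close>, so the bad balls cannot block all geodesics if \<open>vol R\<close> exceeds \<open>R * vol L\<close> by a
  large constant factor. Since the growth is polynomial and superlinear, such a scale \<open>R\<close> exists between \<open>L\<close>
  and \<open>L ^ G\<close> for a fixed exponent \<open>G\<close>. Hence a bad vertex at scale \<open>R\<close> requires \<open>J\<close>
  independent bad vertices at scale \<open>L\<close>, and with \<open>J = 2 * G\<close> the probability of being bad decays
  polynomially along the scales, uniformly in \<open>p\<close> close to 1.\<close>

section \<open>Walks and distances\<close>

lemma walk_single_iff: "walk V E x [a] y \<longleftrightarrow> a \<in> V \<and> x = a \<and> y = a"
  by (auto simp: walk_def)

lemma walk_Cons_Cons_iff:
  "walk V E x (a # b # xs) y \<longleftrightarrow> x = a \<and> a \<in> V \<and> {a, b} \<in> E \<and> walk V E b (b # xs) y"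
proof -
  have "(\<forall>i. Suc i < length (a # b # xs) \<longrightarrow> {(a # b # xs) ! i, (a # b # xs) ! Suc i} \<in> E) \<longleftrightarrow>
      {a, b} \<in> E \<and> (\<forall>i. Suc i < length (b # xs) \<longrightarrow> {(b # xs) ! i, (b # xs) ! Suc i} \<in> E)"
    (is "(\<forall>i. ?P i) \<longleftrightarrow> _ \<and> (\<forall>i. ?Q i)")
  proof -
    have "(\<forall>i. ?P i) \<longleftrightarrow> ?P 0 \<and> (\<forall>i. ?P (Suc i))"
      by (metis nat.exhaust)
    then show ?thesis by simp
  qed
  then show ?thesis
    unfolding walk_def by auto
qed

lemma walk_hd: "walk V E x xs y \<Longrightarrow> \<exists>ys. xs = x # ys"
  by (cases xs) (auto simp: walk_def)

lemma walk_in_verts: "walk V E x xs y \<Longrightarrow> x \<in> V \<and> y \<in> V"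
  by (auto simp: walk_def)

lemma walk_append:
  assumes "walk V E x xs y" "walk V E y ys z"
  shows "walk V E x (xs @ tl ys) z"
  using assms(1)
proof (induction xs arbitrary: x)
  case Nil then show ?case by (simp add: walk_def)
next
  case (Cons a xs)
  show ?case
  proof (cases xs)
    case Nil
    with Cons.prems have "x = y" "a = y" by (auto simp: walk_single_iff)
    then show ?thesis using Nil assms(2) walk_hd[OF assms(2)] by auto
  next
    case (Cons b bs)
    with Cons.prems have "x = a" "a \<in> V" "{a, b} \<in> E" "walk V E b xs y"
      by (auto simp: walk_Cons_Cons_iff)
    with Cons.IH[of b] show ?thesis using Cons by (simp add: walk_Cons_Cons_iff)
  qed
qed

lemma walk_rev:
  assumes "walk V E x xs y" shows "walk V E y (rev xs) x"
  using assms
proof (induction xs arbitrary: x)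
  case Nil then show ?case by (simp add: walk_def)
next
  case (Cons a xs)
  show ?case
  proof (cases xs)
    case Nil
    then show ?thesis using Cons.prems by (auto simp: walk_single_iff)
  next
    case (Cons b bs)
    with Cons.prems have *: "x = a" "a \<in> V" "{a, b} \<in> E" "walk V E b xs y"
      by (auto simp: walk_Cons_Cons_iff)
    have b: "b \<in> V" using *(4) walk_in_verts by metis
    have "walk V E b [b, a] a"
      using * b by (auto simp: walk_Cons_Cons_iff walk_single_iff insert_commute)
    from walk_append[OF Cons.IH[OF *(4)] this] show ?thesis using * by simp
  qed
qed

lemma walk_take:
  assumes "walk V E x xs y" "i < length xs"
  shows "walk V E x (take (Suc i) xs) (xs ! i)"
proof -
  have "set (take (Suc i) xs) \<subseteq> V"
    using assms(1) set_take_subset[of "Suc i" xs] by (auto simp: walk_def)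
  moreover have "last (take (Suc i) xs) = xs ! i"
    using assms(2) by (simp add: take_Suc_conv_app_nth)
  moreover have "hd (take (Suc i) xs) = x" "take (Suc i) xs \<noteq> []"
    using assms by (auto simp: walk_def)
  ultimately show ?thesis using assms by (simp add: walk_def)
qed

section \<open>Distances and balls in a connected graph\<close>

locale connected_simple_graph =
  fixes V :: "'v set" and E :: "'v set set"
  assumes simple: "simple_graph V E" and connected: "connected_graph V E"
begin

text \<open>A \<open>nat\<close>-valued form of \<open>graph_dist\<close> (see
  \<open>graph_dist_eq\<close>): connectedness makes all distances finite. The value is meaningful
  only between vertices of \<open>V\<close>.\<close>

definition d :: "'v \<Rightarrow> 'v \<Rightarrow> nat" where
  "d x y = (LEAST n. \<exists>xs. walk V E x xs y \<and> length xs = Suc n)"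

lemma edge_in_verts: "{a, b} \<in> E \<Longrightarrow> a \<in> V \<and> b \<in> V"
  using simple unfolding simple_graph_def by (metis doubleton_eq_iff)

lemma ex_walk: "x \<in> V \<Longrightarrow> y \<in> V \<Longrightarrow> \<exists>xs. walk V E x xs y"
  using connected unfolding connected_graph_def by blast

lemma d_le: "walk V E x xs y \<Longrightarrow> length xs \<le> Suc n \<Longrightarrow> d x y \<le> n"
proof -
  assume w: "walk V E x xs y" and l: "length xs \<le> Suc n"
  then have "xs \<noteq> []" by (auto simp: walk_def)
  then have "length xs = Suc (length xs - 1)" by (cases xs) auto
  with w have "d x y \<le> length xs - 1" unfolding d_def by (intro Least_le) blast
  with l show ?thesis by simp
qed

lemma ex_walk_d:
  assumes "x \<in> V" "y \<in> V"
  shows "\<exists>xs. walk V E x xs y \<and> length xs = Suc (d x y)"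
proof -
  obtain xs where xs: "walk V E x xs y" using ex_walk assms by blast
  then have "xs \<noteq> []" by (auto simp: walk_def)
  then have "length xs = Suc (length xs - 1)" by (cases xs) auto
  with xs have "\<exists>n xs. walk V E x xs y \<and> length xs = Suc n" by blast
  then show ?thesis unfolding d_def by (rule LeastI_ex)
qed

lemma d_triangle:
  assumes "x \<in> V" "y \<in> V" "z \<in> V"
  shows "d x z \<le> d x y + d y z"
proof -
  obtain xs ys where "walk V E x xs y" "length xs = Suc (d x y)" "walk V E y ys z" "length ys = Suc (d y z)"
    using ex_walk_d assms by metis
  then show ?thesis by (intro d_le[OF walk_append]) auto
qed

lemma d_sym: "x \<in> V \<Longrightarrow> y \<in> V \<Longrightarrow> d x y = d y x"
proof -
  have "d x y \<le> d y x" if "x \<in> V" "y \<in> V" for x y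
    using ex_walk_d[OF that(2,1)] walk_rev d_le by (metis length_rev order_refl)
  then show "x \<in> V \<Longrightarrow> y \<in> V \<Longrightarrow> d x y = d y x" by (simp add: antisym)
qed

lemma d_self [simp]: "x \<in> V \<Longrightarrow> d x x = 0"
  using d_le[of x "[x]" x 0] by (simp add: walk_single_iff)

lemma d_edge: "{x, y} \<in> E \<Longrightarrow> d x y \<le> 1"
  using edge_in_verts by (intro d_le[of _ "[x, y]"]) (auto simp: walk_Cons_Cons_iff walk_single_iff)

lemma graph_dist_eq:
  assumes "x \<in> V" "y \<in> V"
  shows "graph_dist V E x y = enat (d x y)"
proof (rule antisym)
  obtain xs where "walk V E x xs y" "length xs = Suc (d x y)" using ex_walk_d assms by metis
  then show "graph_dist V E x y \<le> enat (d x y)"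
    unfolding graph_dist_def by (intro Inf_lower) force
  show "enat (d x y) \<le> graph_dist V E x y"
    unfolding graph_dist_def by (intro Inf_greatest) (auto intro!: d_le)
qed

abbreviation "gball \<equiv> graph_ball V E"

lemma mem_gball: "x \<in> V \<Longrightarrow> y \<in> gball x r \<longleftrightarrow> y \<in> V \<and> d x y \<le> r"
  by (auto simp: graph_ball_def graph_dist_eq)

lemma ball_subset_verts: "gball x r \<subseteq> V"
  by (auto simp: graph_ball_def)

lemma ball_mono: "r \<le> s \<Longrightarrow> gball x r \<subseteq> gball x s"
  by (auto simp: graph_ball_def intro: order_trans)

lemma ball_subset_ball:
  assumes "x \<in> V" "y \<in> V" "d x y + r \<le> s"
  shows "gball y r \<subseteq> gball x s"
  using assms d_triangle by (fastforce simp: mem_gball)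

subsection \<open>Connections inside a set of vertices\<close>

text \<open>As a closure instead of a set of walks, this is at once symmetric, transitive and
  monotone in \<open>S\<close>. The conjunct \<open>u \<in> S\<close> excludes the trivial pair at a
  vertex outside \<open>S\<close>.\<close>

definition linked :: "'v set \<Rightarrow> 'v \<Rightarrow> 'v \<Rightarrow> bool" where
  "linked S u v \<longleftrightarrow> u \<in> S \<and> (\<lambda>x y. x \<in> S \<and> y \<in> S \<and> {x, y} \<in> E)\<^sup>*\<^sup>* u v"

lemma linked_refl: "u \<in> S \<Longrightarrow> linked S u u"
  by (simp add: linked_def)

lemma linked_edge: "u \<in> S \<Longrightarrow> v \<in> S \<Longrightarrow> {u, v} \<in> E \<Longrightarrow> linked S u v"
  by (auto simp: linked_def)

lemma linked_induct [consumes 1, case_names refl step]: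
  assumes "linked S u v" "u \<in> S \<Longrightarrow> P u"
    and "\<And>y z. linked S u y \<Longrightarrow> y \<in> S \<Longrightarrow> z \<in> S \<Longrightarrow> {y, z} \<in> E \<Longrightarrow> P y \<Longrightarrow> P z"
  shows "P v"
proof -
  from assms(1) have u: "u \<in> S" and "(\<lambda>x y. x \<in> S \<and> y \<in> S \<and> {x, y} \<in> E)\<^sup>*\<^sup>* u v"
    by (auto simp: linked_def)
  from this(2) show ?thesis
  proof (induction rule: rtranclp_induct)
    case base then show ?case using assms(2) u by simp
  next
    case (step y z) then show ?case using assms(3)[of y z] u by (auto simp: linked_def)
  qed
qed

lemma linked_in: "linked S u v \<Longrightarrow> u \<in> S \<and> v \<in> S"
  by (rule conjI, simp add: linked_def) (induction rule: linked_induct, auto)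

lemma linked_trans: "linked S u v \<Longrightarrow> linked S v w \<Longrightarrow> linked S u w"
  by (auto simp: linked_def)

lemma linked_sym: "linked S u v \<Longrightarrow> linked S v u"
proof (induction rule: linked_induct)
  case (step y z)
  then have "linked S z y" by (auto intro: linked_edge simp: insert_commute)
  with step show ?case by (blast intro: linked_trans)
qed (rule linked_refl)

lemma linked_mono: "linked S u v \<Longrightarrow> S \<subseteq> T \<Longrightarrow> linked T u v"
proof (induction rule: linked_induct)
  case (step y z)
  then show ?case by (meson linked_edge linked_trans subsetD)
qed (auto intro: linked_refl)

lemma walk_linked:
  assumes "walk V' E' x xs y" "E' \<subseteq> E" "set xs \<subseteq> S"
  shows "linked S x y"
  using assms(1,3)
proof (induction xs arbitrary: x)
  case Nil then show ?case by (simp add: walk_def)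
next
  case (Cons a xs)
  show ?case
  proof (cases xs)
    case Nil
    then show ?thesis using Cons.prems by (auto simp: walk_single_iff linked_refl)
  next
    case (Cons b bs)
    with Cons.prems have *: "x = a" "{a, b} \<in> E" "walk V' E' b xs y"
      using assms(2) by (auto simp: walk_Cons_Cons_iff)
    then show ?thesis
      using Cons Cons.IH[of b] Cons.prems by (auto intro: linked_trans[OF linked_edge])
  qed
qed

lemma linked_walk:
  assumes "linked S x y" "S \<subseteq> V"
  shows "\<exists>xs. walk S (induced_edges E S) x xs y"
  using assms
proof (induction rule: linked_induct)
  case refl then show ?case by (auto intro!: exI[of _ "[x]"] simp: walk_single_iff)
next
  case (step y z)
  then obtain xs where "walk S (induced_edges E S) x xs y" by blast
  moreover have "walk S (induced_edges E S) y [y, z] z"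
    using step by (auto simp: walk_Cons_Cons_iff walk_single_iff induced_edges_def)
  ultimately show ?case using walk_append by metis
qed

lemma walk_set_dist:
  assumes "walk V E x xs y" "length xs \<le> Suc n" "z \<in> set xs"
  shows "d x z \<le> n"
proof -
  obtain i where "i < length xs" "z = xs ! i" using assms(3) by (metis in_set_conv_nth)
  then show ?thesis using assms(2) by (auto intro!: d_le[OF walk_take[OF assms(1)]])
qed

lemma linked_ball:
  assumes "x \<in> V" "y \<in> gball x r" shows "linked (gball x r) x y"
proof -
  have y: "y \<in> V" "d x y \<le> r" using assms by (auto simp: mem_gball)
  obtain xs where xs: "walk V E x xs y" "length xs = Suc (d x y)"
    using ex_walk_d assms(1) y by metis
  then have "set xs \<subseteq> gball x r"
    using walk_set_dist[OF xs(1)] y assms(1) by (auto simp: mem_gball walk_def)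
  then show ?thesis using walk_linked[OF xs(1)] by blast
qed

text \<open>A discrete intermediate value property: the distance from \<open>u\<close> grows by at
  most 1 along an edge. Stopping when it first reaches \<open>n\<close> keeps the connection inside
  \<open>gball u n\<close>.\<close>

lemma linked_at_distance:
  assumes "linked S u v" "S \<subseteq> V" "n \<le> d u v"
  shows "\<exists>w. linked (S \<inter> gball u n) u w \<and> d u w = n"
proof -
  have u: "u \<in> V" "u \<in> S" using linked_in assms by blast+
  \<comment> \<open>Invariant: either the sphere of radius \<open>n\<close> has been reached, or the
    connection is still strictly inside it.\<close>
  have "(\<exists>w. linked (S \<inter> gball u n) u w \<and> d u w = n) \<or> (linked (S \<inter> gball u n) u v \<and> d u v < n)"
    using assms(1)
  proof (induction rule: linked_induct)
    case refl
    have "linked (S \<inter> gball u n) u u" using u by (auto intro!: linked_refl simp: mem_gball)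
    then show ?case using u by (cases "n = 0") (auto intro!: exI[of _ u])
  next
    case (step y z)
    show ?case
    proof (cases "\<exists>w. linked (S \<inter> gball u n) u w \<and> d u w = n")
      case False
      with step have y: "linked (S \<inter> gball u n) u y" "d u y < n" by auto
      have yz: "y \<in> V" "z \<in> V" using step assms by auto
      have "d u z \<le> n" using d_triangle[of u y z] d_edge[of y z] u yz step y by simp
      then have "z \<in> S \<inter> gball u n" "y \<in> S \<inter> gball u n" using step yz u y by (auto simp: mem_gball)
      then have "linked (S \<inter> gball u n) u z" using y step by (meson linked_edge linked_trans)
      then show ?thesis using \<open>d u z \<le> n\<close> by (cases "d u z = n") auto
    qed simp
  qed
  then show ?thesis using assms(3) by auto
qed

text \<open>The balls around \<open>F\<close> block fewer than \<open>R + 1\<close> of the distances from \<open>u\<close> that occur on the way to \<open>v\<close>.\<close>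

lemma linked_avoiding_balls:
  assumes "linked S u v" "S \<subseteq> V" "F \<subseteq> V" "finite F" "R \<le> d u v" "card F * (2 * \<sigma> + 1) \<le> R"
  shows "\<exists>a. linked S u a \<and> d u a \<le> R \<and> (\<forall>z\<in>F. \<sigma> < d z a)"
proof (rule ccontr)
  assume neg: "\<not> ?thesis"
  have u: "u \<in> V" using linked_in assms by blast
  \<comment> \<open>If every vertex reached within distance \<open>R\<close> were close to a centre,
    the triangle inequality would put each of the \<open>R + 1\<close> distances within \<sigma> of
    some \<open>d u z\<close>, where there is room for at most \<open>R\<close>.\<close>
  have "{..R} \<subseteq> (\<Union>z\<in>F. {d u z - \<sigma>..d u z + \<sigma>})"
  proof
    fix n assume "n \<in> {..R}"
    then obtain w where w: "linked (S \<inter> gball u n) u w" "d u w = n"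
      using linked_at_distance[of S u v n] assms by auto
    have wV: "w \<in> V" using linked_in[OF w(1)] assms by auto
    have "linked S u w" using linked_mono[OF w(1)] by blast
    with neg \<open>n \<in> {..R}\<close> w obtain z where z: "z \<in> F" "d z w \<le> \<sigma>" by (auto simp: not_less)
    have "z \<in> V" using z assms by auto
    have "d u w \<le> d u z + d z w" "d u z \<le> d u w + d z w"
      using d_triangle[of u z w] d_triangle[of u w z] d_sym[of z w] u wV \<open>z \<in> V\<close> by auto
    then show "n \<in> (\<Union>z\<in>F. {d u z - \<sigma>..d u z + \<sigma>})" using z w by force
  qed
  then have "card {..R} \<le> card (\<Union>z\<in>F. {d u z - \<sigma>..d u z + \<sigma>})"
    using assms(4) by (intro card_mono) auto
  also have "\<dots> \<le> (\<Sum>z\<in>F. card {d u z - \<sigma>..d u z + \<sigma>})"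
    by (rule card_UN_le[OF assms(4)])
  also have "\<dots> \<le> (\<Sum>z\<in>F. 2 * \<sigma> + 1)" by (intro sum_mono) auto
  finally show False using assms(6) by simp
qed

end

section \<open>The flow along geodesics of a transitive graph\<close>

lemma graph_automorphism_mem: "graph_automorphism V E \<phi> \<Longrightarrow> x \<in> V \<Longrightarrow> \<phi> x \<in> V"
  by (auto simp: graph_automorphism_def bij_betw_def)

lemma graph_automorphism_inv:
  assumes "graph_automorphism V E \<phi>"
  shows "graph_automorphism V E (inv_into V \<phi>)"
proof -
  have bij: "bij_betw \<phi> V V" using assms by (simp add: graph_automorphism_def)
  have "bij_betw (inv_into V \<phi>) V V" using bij by (rule bij_betw_inv_into)
  moreover have "{inv_into V \<phi> x, inv_into V \<phi> y} \<in> E \<longleftrightarrow> {x, y} \<in> E" if "x \<in> V" "y \<in> V" for x y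
  proof -
    have "inv_into V \<phi> x \<in> V" "inv_into V \<phi> y \<in> V" "\<phi> (inv_into V \<phi> x) = x" "\<phi> (inv_into V \<phi> y) = y"
      using bij that by (auto simp: bij_betw_def inv_into_into f_inv_into_f)
    then show ?thesis using assms unfolding graph_automorphism_def by metis
  qed
  ultimately show ?thesis by (simp add: graph_automorphism_def)
qed

lemma graph_automorphism_walk:
  assumes "graph_automorphism V E \<phi>" "walk V E x xs y"
  shows "walk V E (\<phi> x) (map \<phi> xs) (\<phi> y)"
proof -
  have V: "set xs \<subseteq> V" using assms(2) by (simp add: walk_def)
  have "{map \<phi> xs ! i, map \<phi> xs ! Suc i} \<in> E" if "Suc i < length xs" for i
  proof -
    have "xs ! i \<in> V" "xs ! Suc i \<in> V" "{xs ! i, xs ! Suc i} \<in> E"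
      using V that assms(2) nth_mem[of i xs] nth_mem[of "Suc i" xs] by (auto simp: walk_def)
    then show ?thesis using assms(1) that by (simp add: graph_automorphism_def)
  qed
  moreover have "set (map \<phi> xs) \<subseteq> V" using V graph_automorphism_mem[OF assms(1)] by auto
  ultimately show ?thesis using assms(2) by (auto simp: walk_def hd_map last_map)
qed

text \<open>Finite balls and infinitely many vertices are all that the geometric and probabilistic
  lemmas take from the growth hypothesis; its quantitative form enters in
  \<open>growing_graph\<close>.\<close>

locale transitive_graph = connected_simple_graph V E for V :: "'v set" and E :: "'v set set" +
  assumes transitive: "vertex_transitive V E"
    and finite_ball: "v \<in> V \<Longrightarrow> finite (gball v r)"
    and infinite_verts: "infinite V"
begin

lemma automorphism_ex: "x \<in> V \<Longrightarrow> y \<in> V \<Longrightarrow> \<exists>\<phi>. graph_automorphism V E \<phi> \<and> \<phi> x = y"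
  using transitive unfolding vertex_transitive_def by blast

lemma automorphism_d:
  assumes "graph_automorphism V E \<phi>" "x \<in> V" "y \<in> V"
  shows "d (\<phi> x) (\<phi> y) = d x y"
proof -
  have le: "d (\<psi> x) (\<psi> y) \<le> d x y" if "graph_automorphism V E \<psi>" "x \<in> V" "y \<in> V" for \<psi> x y
    using ex_walk_d[OF that(2,3)] graph_automorphism_walk[OF that(1)] by (metis d_le length_map order_refl)
  have inj: "inj_on \<phi> V" using assms by (auto simp: graph_automorphism_def bij_betw_def)
  have "d (inv_into V \<phi> (\<phi> x)) (inv_into V \<phi> (\<phi> y)) \<le> d (\<phi> x) (\<phi> y)"
    using assms graph_automorphism_mem by (intro le graph_automorphism_inv) auto
  then show ?thesis using le[OF assms] inj assms by (simp add: inv_into_f_f)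
qed

lemma automorphism_ball:
  assumes "graph_automorphism V E \<phi>" "x \<in> V"
  shows "bij_betw \<phi> (gball x r) (gball (\<phi> x) r)"
proof -
  have bij: "bij_betw \<phi> V V" using assms by (simp add: graph_automorphism_def)
  have "\<phi> ` gball x r = gball (\<phi> x) r"
  proof
    show "\<phi> ` gball x r \<subseteq> gball (\<phi> x) r"
      using assms automorphism_d graph_automorphism_mem by (fastforce simp: mem_gball)
    show "gball (\<phi> x) r \<subseteq> \<phi> ` gball x r"
    proof
      fix y assume "y \<in> gball (\<phi> x) r"
      then have y: "y \<in> V" "d (\<phi> x) y \<le> r" using assms graph_automorphism_mem by (fastforce simp: mem_gball)+
      then obtain z where "z \<in> V" "y = \<phi> z" using bij by (auto simp: bij_betw_def)
      with y assms show "y \<in> \<phi> ` gball x r" by (auto simp: mem_gball automorphism_d)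
    qed
  qed
  then show ?thesis using bij ball_subset_verts by (metis bij_betw_subset)
qed

text \<open>The base vertex is irrelevant: by transitivity all balls of the same radius have equally
  many elements (\<open>card_ball\<close>).\<close>

definition vol :: "nat \<Rightarrow> nat" where
  "vol r = card (gball (SOME v. v \<in> V) r)"

lemma card_ball: assumes "x \<in> V" shows "card (gball x r) = vol r"
proof -
  have "(SOME v. v \<in> V) \<in> V" using assms by (rule someI)
  then show ?thesis unfolding vol_def
    using automorphism_ex assms automorphism_ball bij_betw_same_card by metis
qed

lemma verts_nonempty: "V \<noteq> {}" using infinite_verts by auto

lemma vol_mono: "r \<le> s \<Longrightarrow> vol r \<le> vol s"
proof -
  assume "r \<le> s"
  obtain x where "x \<in> V" using verts_nonempty by auto
  then have "card (gball x r) \<le> card (gball x s)"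
    using \<open>r \<le> s\<close> by (intro card_mono finite_ball ball_mono)
  then show ?thesis using \<open>x \<in> V\<close> card_ball by simp
qed

lemma vol_pos: "0 < vol r"
proof -
  obtain x where x: "x \<in> V" using verts_nonempty by auto
  then have "x \<in> gball x r" by (simp add: mem_gball)
  then show ?thesis using card_ball[OF x] finite_ball[OF x] by (metis card_gt_0_iff emptyE)
qed

lemma ex_at_distance:
  assumes "x \<in> V" shows "\<exists>y\<in>V. d x y = n"
proof -
  have "\<not> V \<subseteq> gball x n" using finite_ball[OF assms] infinite_verts finite_subset by blast
  then obtain y where y: "y \<in> V" "n < d x y" using assms by (meson mem_gball not_le subsetI)
  have "linked V x y"
    using linked_ball[of x y "d x y"] assms y ball_subset_verts linked_mono by (auto simp: mem_gball)
  then obtain w where "linked (V \<inter> gball x n) x w" "d x w = n" using linked_at_distance[of V x y n] y by auto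
  then show ?thesis using linked_in by blast
qed

section \<open>Uniformly random geodesics and the flow they carry\<close>

definition geodesics :: "'v \<Rightarrow> 'v \<Rightarrow> 'v list set" where
  "geodesics x y = {xs. walk V E x xs y \<and> length xs = Suc (d x y)}"

lemma geodesic_subset_ball: "xs \<in> geodesics x y \<Longrightarrow> set xs \<subseteq> gball x (d x y)"
proof
  fix z assume xs: "xs \<in> geodesics x y" and z: "z \<in> set xs"
  then have w: "walk V E x xs y" "length xs \<le> Suc (d x y)" by (auto simp: geodesics_def)
  have "z \<in> V" "x \<in> V" using w(1) z by (auto simp: walk_def)
  then show "z \<in> gball x (d x y)" using walk_set_dist[OF w z] by (simp add: mem_gball)
qed

lemma finite_geodesics: "x \<in> V \<Longrightarrow> finite (geodesics x y)"
proof -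
  assume "x \<in> V"
  then have "finite {xs. set xs \<subseteq> gball x (d x y) \<and> length xs = Suc (d x y)}"
    by (intro finite_lists_length_eq finite_ball)
  then show ?thesis
    using geodesic_subset_ball by (rule_tac finite_subset) (auto simp: geodesics_def)
qed

lemma geodesics_nonempty: "x \<in> V \<Longrightarrow> y \<in> V \<Longrightarrow> geodesics x y \<noteq> {}"
  using ex_walk_d by (auto simp: geodesics_def)

lemma card_geodesics_pos: "x \<in> V \<Longrightarrow> y \<in> V \<Longrightarrow> 0 < card (geodesics x y)"
  by (simp add: card_gt_0_iff finite_geodesics geodesics_nonempty)

text \<open>The probability that a uniformly random geodesic from \<open>x\<close> to
  \<open>y\<close> visits \<open>z\<close>. Averaging over all geodesics, instead of selecting one,
  makes it invariant under automorphisms.\<close>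

definition share :: "'v \<Rightarrow> 'v \<Rightarrow> 'v \<Rightarrow> real" where
  "share x y z = card {xs \<in> geodesics x y. z \<in> set xs} / card (geodesics x y)"

lemma share_nonneg: "0 \<le> share x y z"
  by (simp add: share_def)

text \<open>The left side is the expected number of vertices of \<open>A\<close> on a random
  geodesic, which has at most \<open>d x y + 1\<close> vertices in all. The proof counts pairs of a
  geodesic and a vertex on it in two ways.\<close>

lemma sum_share_le:
  assumes "x \<in> V" "y \<in> V" "finite A"
  shows "(\<Sum>z\<in>A. share x y z) \<le> real (Suc (d x y))"
proof -
  have "(\<Sum>z\<in>A. card {xs \<in> geodesics x y. z \<in> set xs}) = (\<Sum>xs\<in>geodesics x y. card {z \<in> A. z \<in> set xs})"
    using assms finite_geodesics by (intro sum_multicount_gen) auto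
  also have "\<dots> \<le> (\<Sum>xs\<in>geodesics x y. Suc (d x y))"
  proof (intro sum_mono)
    fix xs assume "xs \<in> geodesics x y"
    then have "card (set xs) \<le> Suc (d x y)" using card_length[of xs] by (auto simp: geodesics_def)
    moreover have "card {z \<in> A. z \<in> set xs} \<le> card (set xs)" by (intro card_mono) auto
    ultimately show "card {z \<in> A. z \<in> set xs} \<le> Suc (d x y)" by simp
  qed
  finally have "(\<Sum>z\<in>A. card {xs \<in> geodesics x y. z \<in> set xs}) \<le> card (geodesics x y) * Suc (d x y)"
    by simp
  then have "real (\<Sum>z\<in>A. card {xs \<in> geodesics x y. z \<in> set xs}) \<le> real (card (geodesics x y) * Suc (d x y))"
    by (rule of_nat_mono)
  then show ?thesis
    using card_geodesics_pos[OF assms(1,2)]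
    by (simp add: share_def sum_divide_distrib[symmetric] divide_le_eq algebra_simps)
qed

text \<open>A union bound for the random geodesic, which meets \<open>Z\<close> with probability
  1.\<close>

lemma sum_share_ge:
  assumes "x \<in> V" "y \<in> V" "finite Z" "\<And>xs. xs \<in> geodesics x y \<Longrightarrow> set xs \<inter> Z \<noteq> {}"
  shows "1 \<le> (\<Sum>z\<in>Z. share x y z)"
proof -
  have "(\<Sum>z\<in>Z. card {xs \<in> geodesics x y. z \<in> set xs}) = (\<Sum>xs\<in>geodesics x y. card {z \<in> Z. z \<in> set xs})"
    using assms finite_geodesics by (intro sum_multicount_gen) auto
  moreover have "(\<Sum>xs\<in>geodesics x y. 1) \<le> (\<Sum>xs\<in>geodesics x y. card {z \<in> Z. z \<in> set xs})"
  proof (intro sum_mono)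
    fix xs assume "xs \<in> geodesics x y"
    then have "{z \<in> Z. z \<in> set xs} \<noteq> {}" using assms(4) by blast
    then show "1 \<le> card {z \<in> Z. z \<in> set xs}" using assms(3) by (simp add: Suc_le_eq card_gt_0_iff)
  qed
  ultimately have "card (geodesics x y) \<le> (\<Sum>z\<in>Z. card {xs \<in> geodesics x y. z \<in> set xs})" by simp
  then have "real (card (geodesics x y)) \<le> real (\<Sum>z\<in>Z. card {xs \<in> geodesics x y. z \<in> set xs})"
    by (rule of_nat_mono)
  then show ?thesis
    using card_geodesics_pos[OF assms(1,2)]
    by (simp add: share_def sum_divide_distrib[symmetric] le_divide_eq)
qed

lemma automorphism_share:
  assumes "graph_automorphism V E \<phi>" "x \<in> V" "y \<in> V" "z \<in> V"
  shows "share (\<phi> x) (\<phi> y) (\<phi> z) = share x y z"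
proof -
  let ?\<psi> = "inv_into V \<phi>"
  have bij: "bij_betw \<phi> V V" using assms by (simp add: graph_automorphism_def)
  then have inj: "inj_on \<phi> V" by (rule bij_betw_imp_inj_on)
  have inv: "?\<psi> (\<phi> a) = a" if "a \<in> V" for a using inj that by simp
  have inv': "\<phi> (?\<psi> a) = a" if "a \<in> V" for a using bij that by (simp add: bij_betw_inv_into_right)
  have sub: "set xs \<subseteq> V" if "xs \<in> geodesics a b" for xs a b
    using that by (auto simp: geodesics_def walk_def)
  have geo: "map \<theta> xs \<in> geodesics (\<theta> a) (\<theta> b)"
    if "graph_automorphism V E \<theta>" "xs \<in> geodesics a b" "a \<in> V" "b \<in> V" for \<theta> xs a b
    using that graph_automorphism_walk[OF that(1)] automorphism_d[OF that(1)] by (auto simp: geodesics_def)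
  have geo': "map ?\<psi> xs \<in> geodesics x y" if "xs \<in> geodesics (\<phi> x) (\<phi> y)" for xs
    using geo[OF graph_automorphism_inv[OF assms(1)] that] inv assms(2,3)
      graph_automorphism_mem[OF assms(1)] by simp
  have mem: "\<phi> z \<in> set (map \<phi> xs) \<longleftrightarrow> z \<in> set xs" if "set xs \<subseteq> V" for xs
    using inj_on_image_mem_iff[OF inj assms(4) that] by simp
  have mem': "z \<in> set (map ?\<psi> xs) \<longleftrightarrow> \<phi> z \<in> set xs" if "set xs \<subseteq> V" for xs
  proof -
    have "inj_on ?\<psi> V" using bij by (metis bij_betw_def bij_betw_inv_into)
    from inj_on_image_mem_iff[OF this _ that, of "\<phi> z"] show ?thesis
      using inv[OF assms(4)] graph_automorphism_mem[OF assms(1,4)] by simp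
  qed
  have m1: "map ?\<psi> (map \<phi> xs) = xs" if "set xs \<subseteq> V" for xs
    using that inv by (auto intro!: map_idI)
  have m2: "map \<phi> (map ?\<psi> xs) = xs" if "set xs \<subseteq> V" for xs
    using that inv' by (auto intro!: map_idI)
  have 1: "bij_betw (map \<phi>) {xs \<in> geodesics x y. z \<in> set xs} {xs \<in> geodesics (\<phi> x) (\<phi> y). \<phi> z \<in> set xs}"
    by (rule bij_betw_byWitness[where f' = "map ?\<psi>"])
      (use geo[OF assms(1)] geo' m1 m2 mem mem' sub assms(2,3) in \<open>auto simp del: set_map map_map\<close>)
  have 2: "bij_betw (map \<phi>) (geodesics x y) (geodesics (\<phi> x) (\<phi> y))"
    by (rule bij_betw_byWitness[where f' = "map ?\<psi>"])
      (use geo[OF assms(1)] geo' m1 m2 sub assms(2,3) in \<open>auto simp del: set_map map_map\<close>)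
  show ?thesis
    unfolding share_def by (simp only: bij_betw_same_card[OF 1] bij_betw_same_card[OF 2])
qed

text \<open>The total flow through \<open>z\<close> if every vertex sends one unit to each vertex
  within distance \<open>T\<close>. Only sources in \<open>gball z T\<close> can contribute, so the
  finite sum loses nothing.\<close>

definition flow :: "nat \<Rightarrow> 'v \<Rightarrow> real" where
  "flow T z = (\<Sum>u\<in>gball z T. \<Sum>v\<in>gball u T. share u v z)"

lemma automorphism_flow:
  assumes "graph_automorphism V E \<phi>" "z \<in> V"
  shows "flow T (\<phi> z) = flow T z"
proof -
  have "flow T (\<phi> z) = (\<Sum>u\<in>gball z T. \<Sum>v\<in>gball (\<phi> u) T. share (\<phi> u) v (\<phi> z))"
    unfolding flow_def by (rule sum.reindex_bij_betw[OF automorphism_ball[OF assms], symmetric])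
  also have "\<dots> = (\<Sum>u\<in>gball z T. \<Sum>v\<in>gball u T. share (\<phi> u) (\<phi> v) (\<phi> z))"
  proof (rule sum.cong[OF refl])
    fix u assume "u \<in> gball z T"
    then have "u \<in> V" using ball_subset_verts by blast
    then show "(\<Sum>v\<in>gball (\<phi> u) T. share (\<phi> u) v (\<phi> z)) = (\<Sum>v\<in>gball u T. share (\<phi> u) (\<phi> v) (\<phi> z))"
      by (rule sum.reindex_bij_betw[OF automorphism_ball[OF assms(1)], symmetric])
  qed
  also have "\<dots> = flow T z"
    unfolding flow_def using ball_subset_verts assms
    by (intro sum.cong refl automorphism_share) blast+
  finally show ?thesis .
qed

text \<open>By transitivity \<open>flow T\<close> is constant, so it can be averaged over a large ball; this replaces the
  mass transport principle, which would need unimodularity.\<close>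

lemma flow_le:
  assumes "z \<in> V"
  shows "real (vol s) * flow T z \<le> real (vol (s + T)) * (real (vol T) * real (Suc T))"
proof -
  have "real (vol s) * flow T z = (\<Sum>y\<in>gball z s. flow T y)"
  proof -
    have "flow T y = flow T z" if "y \<in> gball z s" for y
      using automorphism_ex[of z y] automorphism_flow assms that ball_subset_verts by blast
    then show ?thesis using card_ball[OF assms] by simp
  qed
  \<comment> \<open>All relevant sources lie in one ball independent of \<open>y\<close>, so the
    sums can be exchanged and the visits counted for each pair \<open>u\<close>, \<open>v\<close>
    separately.\<close>
  also have "\<dots> \<le> (\<Sum>y\<in>gball z s. \<Sum>u\<in>gball z (s + T). \<Sum>v\<in>gball u T. share u v y)"
    unfolding flow_def
  proof (intro sum_mono sum_mono2 finite_ball assms)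
    fix y assume y: "y \<in> gball z s"
    then have "y \<in> V" "d z y \<le> s" using assms by (auto simp: mem_gball)
    then show "gball y T \<subseteq> gball z (s + T)" using assms by (intro ball_subset_ball) auto
  qed (auto intro!: sum_nonneg share_nonneg)
  also have "\<dots> = (\<Sum>u\<in>gball z (s + T). \<Sum>v\<in>gball u T. \<Sum>y\<in>gball z s. share u v y)"
    by (subst sum.swap, rule sum.cong[OF refl], rule sum.swap)
  also have "\<dots> \<le> (\<Sum>u\<in>gball z (s + T). \<Sum>v\<in>gball u T. real (Suc T))"
  proof (intro sum_mono)
    fix u v assume "u \<in> gball z (s + T)" "v \<in> gball u T"
    then have u: "u \<in> V" using ball_subset_verts by blast
    with \<open>v \<in> gball u T\<close> have *: "u \<in> V" "v \<in> V" "d u v \<le> T" by (auto simp: mem_gball)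
    then have "(\<Sum>y\<in>gball z s. share u v y) \<le> real (Suc (d u v))"
      by (intro sum_share_le finite_ball assms)
    then show "(\<Sum>y\<in>gball z s. share u v y) \<le> real (Suc T)" using * by simp
  qed
  also have "\<dots> = (\<Sum>u\<in>gball z (s + T). real (vol T) * real (Suc T))"
    using ball_subset_verts card_ball by (intro sum.cong refl) (simp add: subset_iff)
  also have "\<dots> = real (vol (s + T)) * (real (vol T) * real (Suc T))"
    using card_ball[OF assms] by simp
  finally show ?thesis .
qed

text \<open>Send one unit from each vertex of \<open>gball a \<tau>\<close> to each vertex of
  \<open>gball b \<tau>\<close>. If all geodesics met \<open>Z\<close>, all these units would pass
  through \<open>Z\<close>, but \<open>flow_le\<close> bounds what each vertex of \<open>Z\<close>
  can carry. The averaging radius \<open>s\<close> is free.\<close>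

lemma geodesic_avoiding:
  assumes ab: "a \<in> V" "b \<in> V" and Z: "Z \<subseteq> V" "finite Z" and T: "d a b + 2 * \<tau> \<le> T"
    and small: "card Z * (vol (s + T) * (vol T * Suc T)) < vol s * (vol \<tau>)\<^sup>2"
  shows "\<exists>p\<in>gball a \<tau>. \<exists>q\<in>gball b \<tau>. \<exists>xs. walk V E p xs q \<and> set xs \<inter> Z = {} \<and> set xs \<subseteq> gball a (\<tau> + T)"
proof (rule ccontr)
  assume neg: "\<not> ?thesis"
  have pqV: "p \<in> V" "q \<in> V" if "p \<in> gball a \<tau>" "q \<in> gball b \<tau>" for p q
    using that ball_subset_verts by auto
  have dpq: "d p q \<le> T" if pq: "p \<in> gball a \<tau>" "q \<in> gball b \<tau>" for p q
  proof -
    have "d p q \<le> d p b + d b q" by (rule d_triangle[OF pqV(1)[OF pq] ab(2) pqV(2)[OF pq]])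
    moreover have "d p b \<le> d p a + d a b" by (rule d_triangle[OF pqV(1)[OF pq] ab])
    moreover have "d a p \<le> \<tau>" "d b q \<le> \<tau>" using pq ab by (simp_all add: mem_gball)
    ultimately show ?thesis using T d_sym[OF ab(1) pqV(1)[OF pq]] by simp
  qed
  have ge: "1 \<le> (\<Sum>z\<in>Z. share p q z)" if "p \<in> gball a \<tau>" "q \<in> gball b \<tau>" for p q
  proof (rule sum_share_ge)
    fix xs assume xs: "xs \<in> geodesics p q"
    have "set xs \<subseteq> gball p (d p q)" using geodesic_subset_ball xs .
    also have "\<dots> \<subseteq> gball p T" by (intro ball_mono dpq that)
    also have "\<dots> \<subseteq> gball a (\<tau> + T)"
      using that pqV[OF that] ab by (intro ball_subset_ball) (auto simp: mem_gball)
    finally show "set xs \<inter> Z \<noteq> {}"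
      using neg that xs by (auto simp: geodesics_def)
  qed (use pqV that Z in auto)
  have "real ((vol \<tau>)\<^sup>2) = (\<Sum>p\<in>gball a \<tau>. \<Sum>q\<in>gball b \<tau>. 1)"
    using card_ball ab by (simp add: power2_eq_square)
  also have "\<dots> \<le> (\<Sum>p\<in>gball a \<tau>. \<Sum>q\<in>gball b \<tau>. \<Sum>z\<in>Z. share p q z)"
    by (intro sum_mono ge)
  also have "\<dots> = (\<Sum>z\<in>Z. \<Sum>p\<in>gball a \<tau>. \<Sum>q\<in>gball b \<tau>. share p q z)"
    by (subst (2) sum.swap, rule sum.cong[OF refl], rule sum.swap)
  also have "\<dots> \<le> (\<Sum>z\<in>Z. flow T z)"
  proof (rule sum_mono)
    fix z assume "z \<in> Z"
    then have z: "z \<in> V" using Z by auto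
    \<comment> \<open>A geodesic through \<open>z\<close> starts within distance \<open>T\<close> of
      \<open>z\<close>, so only sources counted in \<open>flow T z\<close> matter.\<close>
    have zero: "share p q z = 0" if pq: "p \<in> gball a \<tau>" "q \<in> gball b \<tau>" "p \<notin> gball z T" for p q
    proof -
      have "z \<notin> set xs" if xs: "xs \<in> geodesics p q" for xs
      proof
        assume "z \<in> set xs"
        then have "d p z \<le> T"
          using geodesic_subset_ball[OF xs] dpq[OF pq(1,2)] pqV[OF pq(1,2)] by (auto simp: mem_gball)
        then show False using pq(3) pqV[OF pq(1,2)] z d_sym[of p z] by (auto simp: mem_gball)
      qed
      then have "{xs \<in> geodesics p q. z \<in> set xs} = {}" by blast
      then show ?thesis unfolding share_def by (simp only:) simp
    qed
    have "(\<Sum>p\<in>gball a \<tau>. \<Sum>q\<in>gball b \<tau>. share p q z)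
        = (\<Sum>p\<in>gball a \<tau> \<inter> gball z T. \<Sum>q\<in>gball b \<tau>. share p q z)"
      using zero by (intro sum.mono_neutral_right finite_ball ab) auto
    also have "\<dots> \<le> (\<Sum>p\<in>gball a \<tau> \<inter> gball z T. \<Sum>q\<in>gball p T. share p q z)"
    proof (intro sum_mono sum_mono2)
      fix p assume p: "p \<in> gball a \<tau> \<inter> gball z T"
      then have "p \<in> V" using ball_subset_verts by blast
      then show "finite (gball p T)" by (rule finite_ball)
      show "gball b \<tau> \<subseteq> gball p T"
        using p dpq pqV \<open>p \<in> V\<close> by (auto simp: mem_gball[OF \<open>p \<in> V\<close>])
    qed (rule share_nonneg)
    also have "\<dots> \<le> flow T z"
      unfolding flow_def using z by (intro sum_mono2 finite_ball) (auto intro!: sum_nonneg share_nonneg)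
    finally show "(\<Sum>p\<in>gball a \<tau>. \<Sum>q\<in>gball b \<tau>. share p q z) \<le> flow T z" .
  qed
  finally have "real ((vol \<tau>)\<^sup>2) \<le> (\<Sum>z\<in>Z. flow T z)" .
  then have "real (vol s) * real ((vol \<tau>)\<^sup>2) \<le> (\<Sum>z\<in>Z. real (vol s) * flow T z)"
    by (simp add: sum_distrib_left[symmetric] mult_left_mono)
  also have "\<dots> \<le> (\<Sum>z\<in>Z. real (vol (s + T)) * (real (vol T) * real (Suc T)))"
    using Z by (intro sum_mono flow_le) auto
  finally have "real (vol s * (vol \<tau>)\<^sup>2) \<le> real (card Z * (vol (s + T) * (vol T * Suc T)))"
    by (simp only: sum_constant of_nat_mult)
  then have "vol s * (vol \<tau>)\<^sup>2 \<le> card Z * (vol (s + T) * (vol T * Suc T))"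
    by (rule of_nat_le_iff[THEN iffD1])
  with small show False by linarith
qed

end

section \<open>Good vertices at a given scale\<close>

context transitive_graph
begin

text \<open>The radii leave room for the constructions below: \<open>18 = 17 + 1\<close> makes the connections of adjacent
  vertices comparable, and \<open>17 = 3 * 5 + 2\<close>, \<open>56 = 3 * 18 + 2\<close> come from \<open>linked_across_bad_balls\<close>.
  Whether \<open>x\<close> is good depends only on the ball of radius \<open>56 * L\<close>, whence the separation \<open>112 * L\<close>.\<close>

definition long_from :: "nat \<Rightarrow> 'v set \<Rightarrow> 'v \<Rightarrow> 'v \<Rightarrow> bool" where
  "long_from L S x u \<longleftrightarrow> (\<exists>v. linked (S \<inter> gball x (17 * L)) u v \<and> L \<le> d u v)"

definition good :: "nat \<Rightarrow> 'v set \<Rightarrow> 'v \<Rightarrow> bool" where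
  "good L S x \<longleftrightarrow> (\<exists>u. long_from L S x u) \<and>
     (\<forall>u v u' v'. linked (S \<inter> gball x (18 * L)) u v \<longrightarrow> L \<le> d u v \<longrightarrow>
        linked (S \<inter> gball x (18 * L)) u' v' \<longrightarrow> L \<le> d u' v' \<longrightarrow> linked (S \<inter> gball x (56 * L)) u u')"

lemma good_cong:
  assumes "S \<inter> gball x (56 * L) = S' \<inter> gball x (56 * L)"
  shows "good L S x \<longleftrightarrow> good L S' x"
proof -
  have "S \<inter> gball x r = S' \<inter> gball x r" if "r \<le> 56 * L" for r
    using assms ball_mono[OF that, of x] by blast
  from this[of "17 * L"] this[of "18 * L"] this[of "56 * L"] show ?thesis
    by (simp add: good_def long_from_def)
qed

lemma good_ex_long: "good L S x \<Longrightarrow> \<exists>u. long_from L S x u"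
  by (simp add: good_def)

lemma good_linked:
  "good L S x \<Longrightarrow> linked (S \<inter> gball x (18 * L)) u v \<Longrightarrow> L \<le> d u v \<Longrightarrow>
     linked (S \<inter> gball x (18 * L)) u' v' \<Longrightarrow> L \<le> d u' v' \<Longrightarrow> linked (S \<inter> gball x (56 * L)) u u'"
  unfolding good_def by blast

lemma long_from_near:
  assumes "x \<in> V" "y \<in> V" "d y x \<le> L" "long_from L S x u"
  shows "\<exists>v. linked (S \<inter> gball y (18 * L)) u v \<and> L \<le> d u v"
proof -
  obtain v where "linked (S \<inter> gball x (17 * L)) u v" "L \<le> d u v" using assms by (auto simp: long_from_def)
  moreover have "gball x (17 * L) \<subseteq> gball y (18 * L)" using assms by (intro ball_subset_ball) auto
  ultimately show ?thesis using linked_mono[of "S \<inter> gball x (17 * L)" u v "S \<inter> gball y (18 * L)"] by blast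
qed

text \<open>The long connections of two adjacent vertices both lie in the ball of radius
  \<open>18 * L\<close> around the first one, whose goodness joins them. Induction along the chain
  \<open>Y\<close> then joins the connections at its two ends.\<close>

lemma linked_of_good_chain:
  assumes "0 < L" "linked Y y y'" "Y \<subseteq> V" "\<And>z. z \<in> Y \<Longrightarrow> good L S z"
    and "long_from L S y u" "long_from L S y' u'"
  shows "linked (S \<inter> (\<Union>z\<in>Y. gball z (56 * L))) u u'"
proof -
  let ?W = "S \<inter> (\<Union>z\<in>Y. gball z (56 * L))"
  have mono: "linked ?W a b" if "linked (S \<inter> gball z (56 * L)) a b" "z \<in> Y" for a b z
    using linked_mono[OF that(1), of ?W] that(2) by blast
  have near: "\<exists>v. linked (S \<inter> gball z (18 * L)) w v \<and> L \<le> d w v"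
    if "long_from L S z' w" "z \<in> Y" "z' \<in> Y" "d z z' \<le> 1" for z z' w
    using that assms(1,3) by (intro long_from_near[of z']) auto
  have near0: "\<exists>v. linked (S \<inter> gball z (18 * L)) w v \<and> L \<le> d w v" if "long_from L S z w" "z \<in> Y" for z w
    using that assms(3) by (intro near[of z]) auto
  have adjacent: "linked ?W w w'" if "long_from L S z w" "long_from L S z' w'" "z \<in> Y" "z' \<in> Y" "d z z' \<le> 1" for z z' w w'
    using near0[OF that(1,3)] near[OF that(2-5)] good_linked[OF assms(4)[OF that(3)]] mono[OF _ that(3)]
    by blast
  \<comment> \<open>The long connection at the moving end changes from vertex to vertex, so
    \<open>u'\<close> must be universally quantified in the induction.\<close>
  have "\<forall>u'. long_from L S y' u' \<longrightarrow> linked ?W u u'"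
    using assms(2)
  proof (induction rule: linked_induct)
    case refl
    then have "d y y \<le> 1" using assms(3) by (simp add: subset_iff)
    then show ?case using adjacent[of y u y] refl assms(5) by blast
  next
    case (step z z')
    obtain w where w: "long_from L S z w" using good_ex_long assms(4) step.hyps by blast
    have "d z z' \<le> 1" using step.hyps d_edge by blast
    then have "linked ?W w u'" if "long_from L S z' u'" for u'
      using adjacent w that step.hyps by blast
    then show ?case using step.IH w linked_trans by blast
  qed
  with assms(6) show ?thesis by blast
qed

text \<open>At least one of \<open>u\<close>, \<open>v\<close> is at distance \<open>L\<close> or
  more from \<open>a\<close>. Cutting the connection at distance exactly \<open>L\<close> fits it
  into the small ball required by \<open>long_from_self\<close>.\<close>

lemma far_endpoint:
  assumes "linked S a u" "linked S a v" "S \<subseteq> V" "2 * L \<le> d u v"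
  shows "\<exists>w. linked (S \<inter> gball a L) a w \<and> d a w = L"
proof -
  have V: "a \<in> V" "u \<in> V" "v \<in> V" using assms linked_in by blast+
  have "d u v \<le> d a u + d a v" using d_triangle[OF V(2,1,3)] d_sym[OF V(1,2)] by simp
  then consider "L \<le> d a u" | "L \<le> d a v" using assms(4) by linarith
  then show ?thesis
    using linked_at_distance[OF assms(1,3)] linked_at_distance[OF assms(2,3)] by cases blast+
qed

lemma long_from_self:
  assumes "linked (S \<inter> gball a L) a w" "d a w = L"
  shows "long_from L S a a"
proof -
  have "S \<inter> gball a L \<subseteq> S \<inter> gball a (17 * L)" using ball_mono[of L "17 * L" a] by auto
  then show ?thesis using linked_mono[OF assms(1)] assms(2) unfolding long_from_def by blast
qed

text \<open>\<open>geodesic_avoiding\<close> provides a walk around the balls \<open>Z\<close> that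
  contain the bad vertices. Extended inside the \<tau>-balls of its ends, it connects
  \<open>a\<close> to \<open>b\<close> through good vertices, and
  \<open>linked_of_good_chain\<close> turns this into an open connection.\<close>

lemma linked_across_bad_balls:
  assumes x: "x \<in> V" and L: "0 < L" "112 * L \<le> \<tau>" and F: "F \<subseteq> V" "finite F" "card F \<le> J" and J: "0 < J"
    and R: "R = 8 * J * \<tau>" and q: "q \<le> 18"
    and small: "J * vol (112 * L) * (vol (40 * R))\<^sup>2 * (40 * R) < vol \<tau> ^ 3"
    and bad: "\<And>y. y \<in> gball x (55 * R) \<Longrightarrow> \<not> good L S y \<Longrightarrow> \<exists>z\<in>F. d z y \<le> 112 * L"
    and a: "a \<in> gball x (q * R)" "\<And>z. z \<in> F \<Longrightarrow> \<tau> + 112 * L < d z a"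
    and b: "b \<in> gball x (q * R)" "\<And>z. z \<in> F \<Longrightarrow> \<tau> + 112 * L < d z b"
    and long_from: "long_from L S a u" "long_from L S b u'"
  shows "linked (S \<inter> gball x ((3 * q + 2) * R)) u u'"
proof -
  \<comment> \<open>The points \<open>a\<close> and \<open>b\<close> are at most
    \<open>2 * q * R\<close> apart, and moving both ends inside their \<tau>-balls costs
    \<open>2 * \<tau>\<close>.\<close>
  define T where "T = 2 * q * R + 2 * \<tau>"
  define Z where "Z = (\<Union>z\<in>F. gball z (112 * L))"
  define Y where "Y = gball x ((3 * q + 1) * R) - Z"
  have tau: "0 < \<tau>" "8 * \<tau> \<le> R" using L J R by auto
  have aV: "a \<in> V" "d x a \<le> q * R" and bV: "b \<in> V" "d x b \<le> q * R" using a b x by (auto simp: mem_gball)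
  have dab: "d a b + 2 * \<tau> \<le> T"
    using d_triangle[of a x b] d_sym[of a x] aV bV x unfolding T_def by simp
  have ZV: "Z \<subseteq> V" unfolding Z_def using ball_subset_verts by blast
  have finZ: "finite Z" unfolding Z_def using F finite_ball by (intro finite_UN_I) auto
  have "card Z \<le> (\<Sum>z\<in>F. card (gball z (112 * L)))" unfolding Z_def by (rule card_UN_le[OF F(2)])
  also have "\<dots> = card F * vol (112 * L)" using F card_ball by (simp add: subset_iff)
  finally have cardZ: "card Z \<le> J * vol (112 * L)" using F(3) by (meson mult_le_mono1 order_trans)
  have qR: "q * R \<le> 18 * R" using q by simp
  have T: "T \<le> 40 * R" "Suc T \<le> 40 * R" "R + T \<le> 40 * R" using qR tau unfolding T_def by linarith+
  \<comment> \<open>The averaging radius is \<open>R\<close>. As \<open>q \<le> 18\<close>, all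
    radii are at most \<open>40 * R\<close>, and \<open>vol \<tau> \<le> vol R\<close> turns
    \<open>small\<close> into the required inequality.\<close>
  have "card Z * (vol (R + T) * (vol T * Suc T)) \<le> (J * vol (112 * L)) * (vol (40 * R) * (vol (40 * R) * (40 * R)))"
    using cardZ T by (intro mult_le_mono vol_mono)
  also have "\<dots> = J * vol (112 * L) * (vol (40 * R))\<^sup>2 * (40 * R)" by (simp add: power2_eq_square)
  also have "\<dots> < vol \<tau> ^ 3" by (rule small)
  also have "\<dots> \<le> vol R * (vol \<tau>)\<^sup>2"
    using vol_mono[of \<tau> R] tau by (simp add: power3_eq_cube power2_eq_square)
  finally have "card Z * (vol (R + T) * (vol T * Suc T)) < vol R * (vol \<tau>)\<^sup>2" .
  from geodesic_avoiding[OF aV(1) bV(1) ZV finZ dab this]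
  obtain p q' xs where p: "p \<in> gball a \<tau>" and q': "q' \<in> gball b \<tau>"
    and xs: "walk V E p xs q'" "set xs \<inter> Z = {}" "set xs \<subseteq> gball a (\<tau> + T)" by blast
  have 3: "3 * \<tau> \<le> R" using tau by simp
  have sub: "gball a (\<tau> + T) \<subseteq> gball x ((3 * q + 1) * R)"
  proof (rule ball_subset_ball[OF x aV(1)])
    have "d x a + (\<tau> + T) \<le> 3 * (q * R) + 3 * \<tau>" using aV(2) unfolding T_def by (simp add: algebra_simps)
    also have "\<dots> \<le> (3 * q + 1) * R" using 3 by (simp add: algebra_simps)
    finally show "d x a + (\<tau> + T) \<le> (3 * q + 1) * R" .
  qed
  \<comment> \<open>The margin \<tau> in the distance to \<open>F\<close> keeps the entire
    \<tau>-ball away from \<open>Z\<close>, so it can be used to reach the geodesic.\<close>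
  have near: "gball c \<tau> \<subseteq> Y" if "c \<in> V" "d x c \<le> q * R" "\<And>z. z \<in> F \<Longrightarrow> \<tau> + 112 * L < d z c" for c
  proof -
    have "gball c \<tau> \<subseteq> gball x ((3 * q + 1) * R)"
    proof (rule ball_subset_ball[OF x that(1)])
      have "\<tau> \<le> R" using tau by simp
      then show "d x c + \<tau> \<le> (3 * q + 1) * R" using that(2) by (simp add: algebra_simps)
    qed
    moreover have "y \<notin> Z" if y: "y \<in> gball c \<tau>" for y
    proof
      assume "y \<in> Z"
      then obtain z where z: "z \<in> F" "y \<in> gball z (112 * L)" unfolding Z_def by blast
      then have zV: "z \<in> V" using F by auto
      have yV: "y \<in> V" "d c y \<le> \<tau>" "d z y \<le> 112 * L"
        using y z zV \<open>c \<in> V\<close> by (auto simp: mem_gball)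
      have "d z c \<le> d z y + d y c" by (rule d_triangle[OF zV yV(1) \<open>c \<in> V\<close>])
      then show False using that(1) \<open>\<And>z. z \<in> F \<Longrightarrow> \<tau> + 112 * L < d z c\<close>[OF z(1)] yV d_sym[OF \<open>c \<in> V\<close> yV(1)] by simp
    qed
    ultimately show ?thesis unfolding Y_def by blast
  qed
  have "linked Y a p"
    using linked_mono[OF linked_ball[OF aV(1) p] near[OF aV a(2)]] .
  moreover have "linked Y p q'"
    using xs sub unfolding Y_def by (intro walk_linked[OF xs(1)]) auto
  moreover have "linked Y q' b"
    using linked_sym[OF linked_mono[OF linked_ball[OF bV(1) q'] near[OF bV b(2)]]] .
  ultimately have "linked Y a b" using linked_trans by blast
  moreover have "Y \<subseteq> V" unfolding Y_def using ball_subset_verts by blast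
  moreover have "good L S z" if "z \<in> Y" for z
  proof (rule ccontr)
    assume ng: "\<not> good L S z"
    have "(3 * q + 1) * R \<le> 55 * R" using q by (intro mult_le_mono1) simp
    from ball_mono[OF this] have "z \<in> gball x (55 * R)" using that unfolding Y_def by blast
    from bad[OF this ng] obtain y where y: "y \<in> F" "d y z \<le> 112 * L" by blast
    have "z \<in> gball y (112 * L)" using y F that \<open>Y \<subseteq> V\<close> by (simp add: mem_gball subset_iff)
    then show False using that y unfolding Y_def Z_def by blast
  qed
  ultimately have "linked (S \<inter> (\<Union>z\<in>Y. gball z (56 * L))) u u'"
    using linked_of_good_chain[OF L(1) _ _ _ long_from] by blast
  moreover have "gball z (56 * L) \<subseteq> gball x ((3 * q + 2) * R)" if "z \<in> Y" for z
  proof -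
    have "z \<in> V" "d x z \<le> (3 * q + 1) * R"
      using that x unfolding Y_def by (auto simp: mem_gball)
    moreover have "56 * L \<le> R" using L tau by simp
    ultimately show ?thesis by (intro ball_subset_ball x) (auto simp: algebra_simps)
  qed
  ultimately show ?thesis by (elim linked_mono) blast
qed

text \<open>Any connection of length \<open>R\<close> has a vertex away from the bad balls, and two
  such vertices are joined by \<open>linked_across_bad_balls\<close>. The case \<open>q = 5\<close>
  gives existence of a long connection, \<open>q = 18\<close> gives uniqueness.\<close>

lemma good_of_few_bad:
  assumes x: "x \<in> V" and S: "S \<subseteq> V" and L: "0 < L" "112 * L \<le> \<tau>"
    and F: "F \<subseteq> V" "finite F" "card F \<le> J" and J: "0 < J" and R: "R = 8 * J * \<tau>"
    and small: "J * vol (112 * L) * (vol (40 * R))\<^sup>2 * (40 * R) < vol \<tau> ^ 3"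
    and bad: "\<And>y. y \<in> gball x (55 * R) \<Longrightarrow> \<not> good L S y \<Longrightarrow> \<exists>z\<in>F. d z y \<le> 112 * L"
  shows "good R S x"
proof -
  \<comment> \<open>Since \<open>112 * L \<le> \<tau>\<close> and \<tau> is positive, each centre
    blocks at most \<open>4 * \<tau> + 1 \<le> 8 * \<tau>\<close> distances.\<close>
  have blocked: "card F * (2 * (\<tau> + 112 * L) + 1) \<le> R"
  proof -
    have "card F * (2 * (\<tau> + 112 * L) + 1) \<le> J * (8 * \<tau>)"
      using F(3) L by (intro mult_le_mono) auto
    then show ?thesis using R by simp
  qed
  have LR: "2 * L \<le> R" "\<tau> \<le> R" "38 * L \<le> R"
  proof -
    have "8 * \<tau> \<le> R" using R J by simp
    then show "2 * L \<le> R" "\<tau> \<le> R" "38 * L \<le> R" using L by linarith+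
  qed
  have *: "\<exists>a. linked S' u a \<and> d u a \<le> R \<and> (\<forall>z\<in>F. \<tau> + 112 * L < d z a)"
    if "linked S' u v" "S' \<subseteq> V" "R \<le> d u v" for S' u v
    by (rule linked_avoiding_balls[OF that(1,2) F(1,2) that(3) blocked])
  have across: "linked (S \<inter> gball x ((3 * q + 2) * R)) u u'"
    if "q \<le> 18" "a \<in> gball x (q * R)" "\<forall>z\<in>F. \<tau> + 112 * L < d z a"
      "b \<in> gball x (q * R)" "\<forall>z\<in>F. \<tau> + 112 * L < d z b" "long_from L S a u" "long_from L S b u'" for a b u u' q
    using that by (intro linked_across_bad_balls[OF x L F J R _ small bad]) auto
  have good_far: "good L S a" if a: "a \<in> gball x (55 * R)" "\<forall>z\<in>F. \<tau> + 112 * L < d z a" for a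
    using bad[OF a(1)] a(2) by force
  have part1: "\<exists>u. long_from R S x u"
  proof -
    \<comment> \<open>With \<open>a\<close> within \<open>R\<close> of \<open>x\<close>,
      \<open>b\<close> within \<open>R\<close> of \<open>t\<close>, and both open endpoints within
      \<open>17 * L\<close> of these, distance \<open>4 * R\<close> leaves at least \<open>R\<close>
      between the open endpoints.\<close>
    obtain t where t: "t \<in> V" "d x t = 4 * R" using ex_at_distance[OF x] by blast
    obtain v where v: "v \<in> V" "d t v = R" using ex_at_distance[OF t(1)] by blast
    obtain w where w: "w \<in> V" "d x w = R" using ex_at_distance[OF x] by blast
    \<comment> \<open>The search runs through all vertices, open or not: \<open>a\<close> and
      \<open>b\<close> need only be good, and goodness then provides the open vertices
      \<open>u\<close> and \<open>u'\<close>.\<close>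
    have "linked (gball x R) x w" using w by (intro linked_ball[OF x]) (simp add: mem_gball x)
    from *[OF this ball_subset_verts] w obtain a
      where a: "linked (gball x R) x a" "d x a \<le> R" "\<forall>z\<in>F. \<tau> + 112 * L < d z a" by auto
    have "linked (gball t R) t v" using v by (intro linked_ball[OF t(1)]) (simp add: mem_gball t)
    from *[OF this ball_subset_verts] v obtain b
      where b: "linked (gball t R) t b" "d t b \<le> R" "\<forall>z\<in>F. \<tau> + 112 * L < d z b" by auto
    have aV: "a \<in> V" and bV: "b \<in> V"
      using linked_in[OF a(1)] linked_in[OF b(1)] ball_subset_verts by auto
    have db: "d x b \<le> 5 * R" using d_triangle[OF x t(1) bV] t b by simp
    have a5: "a \<in> gball x (5 * R)" and b5: "b \<in> gball x (5 * R)"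
      using aV a(2) bV db by (simp_all add: mem_gball x)
    have sub: "gball x (5 * R) \<subseteq> gball x (55 * R)" by (intro ball_mono) simp
    obtain u u' where u: "long_from L S a u" "long_from L S b u'"
      using good_ex_long good_far a5 b5 sub a(3) b(3) by (meson subsetD)
    from across[OF _ a5 a(3) b5 b(3) u] have lk: "linked (S \<inter> gball x (17 * R)) u u'" by simp
    have uV: "u \<in> V" "u' \<in> V" using linked_in[OF lk] S by auto
    have "u \<in> gball a (17 * L)" "u' \<in> gball b (17 * L)"
      using u linked_in unfolding long_from_def by blast+
    then have du: "d a u \<le> 17 * L" "d b u' \<le> 17 * L" using aV bV by (simp_all add: mem_gball)
    have "4 * R \<le> d x a + d a u + d u u' + d u' b + d b t"
      using d_triangle[OF x aV t(1)] d_triangle[OF aV uV(1) t(1)] d_triangle[OF uV(1,2) t(1)]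
        d_triangle[OF uV(2) bV t(1)] t(2) by linarith
    then have "R \<le> d u u'"
      using a(2) b(2) du d_sym[OF bV uV(2)] d_sym[OF bV t(1)] LR by linarith
    with lk show ?thesis unfolding long_from_def by blast
  qed
  \<comment> \<open>Here \<open>a\<close> is found on the open connection itself. As that connection
    has length at least \<open>2 * L\<close>, it also gives a long connection at scale
    \<open>L\<close> starting at \<open>a\<close>.\<close>
  have find: "\<exists>a. linked (S \<inter> gball x (18 * R)) u a \<and> a \<in> gball x (18 * R) \<and>
      (\<forall>z\<in>F. \<tau> + 112 * L < d z a) \<and> long_from L S a a"
    if uv: "linked (S \<inter> gball x (18 * R)) u v" "R \<le> d u v" for u v
  proof -
    let ?S = "S \<inter> gball x (18 * R)"
    have SV: "?S \<subseteq> V" using S by auto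
    obtain a where a: "linked ?S u a" "\<forall>z\<in>F. \<tau> + 112 * L < d z a" using *[OF uv(1) SV uv(2)] by auto
    have "\<exists>w. linked (?S \<inter> gball a L) a w \<and> d a w = L"
    proof (rule far_endpoint[OF _ _ SV])
      show "linked ?S a u" using linked_sym a(1) .
      then show "linked ?S a v" using linked_trans uv(1) by blast
      show "2 * L \<le> d u v" using LR uv(2) by simp
    qed
    then obtain w where w: "linked (?S \<inter> gball a L) a w" "d a w = L" by blast
    have "long_from L S a a" by (rule long_from_self[OF linked_mono[OF w(1)] w(2)]) blast
    then show ?thesis using a linked_in[OF a(1)] by blast
  qed
  have part2: "linked (S \<inter> gball x (56 * R)) u u'"
    if uv: "linked (S \<inter> gball x (18 * R)) u v" "R \<le> d u v" "linked (S \<inter> gball x (18 * R)) u' v'" "R \<le> d u' v'"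
    for u v u' v'
  proof -
    have mono: "S \<inter> gball x (18 * R) \<subseteq> S \<inter> gball x (56 * R)" using ball_mono[of "18 * R" "56 * R" x] by auto
    obtain a where a: "linked (S \<inter> gball x (18 * R)) u a" "a \<in> gball x (18 * R)"
      "\<forall>z\<in>F. \<tau> + 112 * L < d z a" "long_from L S a a" using find[OF uv(1,2)] by blast
    obtain b where b: "linked (S \<inter> gball x (18 * R)) u' b" "b \<in> gball x (18 * R)"
      "\<forall>z\<in>F. \<tau> + 112 * L < d z b" "long_from L S b b" using find[OF uv(3,4)] by blast
    have "linked (S \<inter> gball x (56 * R)) a b"
      using across[OF _ a(2,3) b(2,3) a(4) b(4)] by simp
    then show ?thesis
      using linked_mono[OF a(1) mono] linked_sym[OF linked_mono[OF b(1) mono]] linked_trans by blast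
  qed
  show ?thesis unfolding good_def using part1 part2 by blast
qed

lemma good_if_ball_subset:
  assumes "x \<in> V" "0 < L" "gball x (56 * L) \<subseteq> S"
  shows "good L S x"
proof -
  have sub: "S \<inter> gball x r = gball x r" if "r \<le> 56 * L" for r
    using assms(3) ball_mono[OF that, of x] by blast
  have eq: "S \<inter> gball x (17 * L) = gball x (17 * L)" "S \<inter> gball x (18 * L) = gball x (18 * L)"
    "S \<inter> gball x (56 * L) = gball x (56 * L)" by (intro sub; simp)+
  obtain w where w: "w \<in> V" "d x w = L" using ex_at_distance[OF assms(1)] by blast
  then have "linked (gball x (17 * L)) x w" using assms(1) by (intro linked_ball) (auto simp: mem_gball)
  then have "\<exists>u. long_from L S x u" unfolding long_from_def eq using w by blast
  moreover have "linked (gball x (56 * L)) u u'"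
    if "linked (gball x (18 * L)) u v" "linked (gball x (18 * L)) u' v'" for u v u' v'
  proof -
    have "u \<in> gball x (56 * L)" "u' \<in> gball x (56 * L)"
      using linked_in[OF that(1)] linked_in[OF that(2)] ball_mono[of "18 * L" "56 * L" x] by auto
    from this[THEN linked_ball[OF assms(1)]] show ?thesis by (rule linked_trans[OF linked_sym])
  qed
  ultimately show ?thesis unfolding good_def eq by blast
qed

text \<open>A maximal separated set of bad vertices is either large or a set of centres covering all of them.\<close>

lemma separated_bad_vertices:
  assumes x: "x \<in> V" and S: "S \<subseteq> V" and L: "0 < L" "112 * L \<le> \<tau>" and J: "0 < J" and R: "R = 8 * J * \<tau>"
    and small: "J * vol (112 * L) * (vol (40 * R))\<^sup>2 * (40 * R) < vol \<tau> ^ 3"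
    and bad: "\<not> good R S x"
  shows "\<exists>F\<subseteq>gball x (55 * R). card F = J \<and> (\<forall>y\<in>F. \<not> good L S y) \<and>
           (\<forall>y\<in>F. \<forall>z\<in>F. y \<noteq> z \<longrightarrow> 112 * L < d y z)"
proof -
  define P where "P F \<longleftrightarrow> F \<subseteq> gball x (55 * R) \<and> (\<forall>y\<in>F. \<not> good L S y) \<and>
    (\<forall>y\<in>F. \<forall>z\<in>F. y \<noteq> z \<longrightarrow> 112 * L < d y z)" for F
  have "\<exists>F. P F \<and> card F = n" if "n \<le> J" for n
    using that
  proof (induction n)
    case 0
    have "P {}" by (simp add: P_def)
    then show ?case by (intro exI[of _ "{}"]) simp
  next
    case (Suc n)
    then obtain F where F: "P F" "card F = n" by auto
    have "F \<subseteq> gball x (55 * R)" using F(1) by (simp add: P_def)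
    then have FV: "F \<subseteq> V" using ball_subset_verts by blast
    have finF: "finite F" using F(1) unfolding P_def by (intro finite_subset[OF _ finite_ball[OF x]]) blast
    have "\<exists>y. y \<in> gball x (55 * R) \<and> \<not> good L S y \<and> (\<forall>z\<in>F. 112 * L < d z y)"
    proof (rule ccontr)
      \<comment> \<open>If no bad vertex can be added, the fewer than \<open>J\<close> balls around
        \<open>F\<close> cover all bad vertices nearby.\<close>
      assume neg: "\<not> ?thesis"
      have "good R S x"
      proof (rule good_of_few_bad[OF x S L FV finF _ J R small])
        show "card F \<le> J" using F Suc.prems by simp
        show "\<exists>z\<in>F. d z y \<le> 112 * L" if "y \<in> gball x (55 * R)" "\<not> good L S y" for y
          using neg that by (meson not_le)
      qed
      then show False using bad by simp
    qed
    then obtain y where y: "y \<in> gball x (55 * R)" "\<not> good L S y" "\<forall>z\<in>F. 112 * L < d z y" by blast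
    have yV: "y \<in> V" using y(1) ball_subset_verts by blast
    have "y \<notin> F" using y(3) yV by auto
    then have "card (insert y F) = Suc n" using F finF by simp
    moreover have "112 * L < d y z" if "z \<in> F" for z
      using y(3) that FV yV by (simp add: d_sym[of y z] subset_iff)
    then have "P (insert y F)" using F(1) y unfolding P_def by auto
    ultimately show ?case by blast
  qed
  then show ?thesis unfolding P_def by blast
qed

end

section \<open>The choice of scales\<close>

locale growing_graph = transitive_graph V E for V :: "'v set" and E :: "'v set set" +
  fixes c \<delta> :: real and A e :: nat
  assumes c_pos: "0 < c" and delta_gt_1: "1 < \<delta>" and e_pos: "0 < e"
    and vol_lower: "1 \<le> r \<Longrightarrow> c * real r powr \<delta> \<le> real (vol r)"
    and vol_upper: "1 \<le> r \<Longrightarrow> vol r \<le> A * r ^ e"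
begin

lemma A_pos: "0 < A"
  using vol_upper[of 1] vol_pos[of 1] by simp

text \<open>If every step multiplied the volume by more than \<open>m ^ (2 * e + 1)\<close>, then
  \<open>vol (m ^ n * X)\<close> would be at least \<open>m ^ ((2 * e + 1) * n)\<close> for the
  largest \<open>m ^ n \<le> X\<close>. The polynomial bound gives at most
  \<open>A * X ^ (2 * e)\<close>; the extra 1 in the exponent beats the constants as
  \<open>X\<close> is large.\<close>

lemma ex_doubling_scale:
  assumes m: "2 \<le> m" and X: "A * m ^ (2 * e + 1) \<le> X"
  shows "\<exists>j. m ^ j \<le> X \<and> vol (m ^ Suc j * X) \<le> m ^ (2 * e + 1) * vol (m ^ j * X)"
proof (rule ccontr)
  assume neg: "\<not> ?thesis"
  let ?D = "m ^ (2 * e + 1)"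
  have X1: "1 \<le> X" using X A_pos m by (metis One_nat_def Suc_leI mult_pos_pos order_less_le_trans pos2 zero_less_power)
  obtain n where n: "m ^ n \<le> X" "X < m ^ (n + 1)" using ex_power_ivl1[OF m X1] by blast
  have "?D ^ j \<le> vol (m ^ j * X)" if "j \<le> n" for j
    using that
  proof (induction j)
    case 0
    then show ?case using vol_pos[of X] by simp
  next
    case (Suc j)
    have "m ^ j \<le> m ^ n" using Suc.prems m by (intro power_increasing) auto
    then have "m ^ j \<le> X" using n by simp
    then have "?D * vol (m ^ j * X) < vol (m ^ Suc j * X)" using neg by (meson not_le)
    moreover have "?D * ?D ^ j \<le> ?D * vol (m ^ j * X)"
      using Suc.prems by (intro mult_le_mono2 Suc.IH) simp
    ultimately have "?D * ?D ^ j \<le> vol (m ^ Suc j * X)" by linarith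
    then show ?case by (simp only: power_Suc)
  qed
  then have "?D ^ n \<le> vol (m ^ n * X)" by simp
  also have "\<dots> \<le> A * (m ^ n * X) ^ e"
    using X1 m by (intro vol_upper) (simp add: Suc_le_eq)
  also have "\<dots> \<le> A * (X * X) ^ e" using n by (intro mult_le_mono2 power_mono mult_le_mono1) auto
  also have "\<dots> = A * X ^ (2 * e)" by (simp add: power_mult power2_eq_square)
  also have "\<dots> \<le> A * (m ^ (n + 1)) ^ (2 * e)" using n by (intro mult_le_mono2 power_mono) auto
  also have "\<dots> = (A * m ^ (2 * e)) * (m ^ n) ^ (2 * e)" by (simp add: power_mult_distrib)
  also have "\<dots> < m ^ n * (m ^ n) ^ (2 * e)"
  proof (intro mult_strict_right_mono)
    have "m * (A * m ^ (2 * e)) \<le> X" using X by (simp add: mult_ac)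
    moreover have "X < m * m ^ n" using n(2) by simp
    ultimately have "m * (A * m ^ (2 * e)) < m * m ^ n" by linarith
    then show "A * m ^ (2 * e) < m ^ n" by (rule mult_less_cancel1[THEN iffD1, THEN conjunct2])
    show "0 < (m ^ n) ^ (2 * e)" using m by simp
  qed
  also have "\<dots> = ?D ^ n" by (simp add: power_mult[symmetric] power_add[symmetric] algebra_simps)
  finally show False by simp
qed

text \<open>Take \<open>X = L ^ g\<close> and a doubling scale \<tau> between \<open>X\<close> and
  \<open>X * X\<close>. Doubling cancels two factors \<open>vol \<tau>\<close> in the smallness
  condition, leaving \<open>K * L ^ e * \<tau> < vol \<tau>\<close>, which holds by superlinear
  growth.\<close>

lemma ex_next_scale:
  "\<exists>G L0. 0 < G \<and> 0 < L0 \<and> (\<forall>L\<ge>L0. \<exists>\<tau>. 112 * L \<le> \<tau> \<and> 8 * (2 * G) * \<tau> \<le> L ^ G \<and>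
     2 * G * vol (112 * L) * (vol (40 * (8 * (2 * G) * \<tau>)))\<^sup>2 * (40 * (8 * (2 * G) * \<tau>)) < vol \<tau> ^ 3)"
proof -
  \<comment> \<open>Ensures that \<open>\<tau> powr (\<delta> - 1)\<close> is at least
    \<open>L ^ (e + 1)\<close>: the factor \<open>L ^ e\<close> pays for
    \<open>vol (112 * L)\<close>, the remaining \<open>L\<close> for \<open>K / c\<close>.\<close>
  obtain g where g: "2 \<le> g" "real e + 1 \<le> real g * (\<delta> - 1)"
  proof -
    obtain g :: nat where "(real e + 1) / (\<delta> - 1) \<le> real g" using real_arch_simple by blast
    then have "(real e + 1) / (\<delta> - 1) \<le> real (g + 2)" by simp
    then have "real e + 1 \<le> real (g + 2) * (\<delta> - 1)" using delta_gt_1 by (simp add: pos_divide_le_eq)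
    then show ?thesis using that[of "g + 2"] by simp
  qed
  \<comment> \<open>As \<open>\<tau> \<le> X * X = L ^ (2 * g)\<close>, one further factor
    \<open>L\<close> absorbs \<open>8 * J\<close>.\<close>
  define G where "G = 2 * g + 1"
  define J where "J = 2 * G"
  \<comment> \<open>The ratio of the two radii to be compared:
    \<open>40 * (8 * J * \<tau>) = m * \<tau>\<close>.\<close>
  define m where "m = 320 * J"
  define D where "D = m ^ (2 * e + 1)"
  define K where "K = J * A * 112 ^ e * D\<^sup>2 * m"
  obtain B :: nat where B: "real K / c < real B" using reals_Archimedean2 by blast
  define L0 where "L0 = 112 + 8 * J + A * D + B"
  have m2: "2 \<le> m" unfolding m_def J_def G_def by simp
  have "\<exists>\<tau>. 112 * L \<le> \<tau> \<and> 8 * J * \<tau> \<le> L ^ G \<and>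
     J * vol (112 * L) * (vol (40 * (8 * J * \<tau>)))\<^sup>2 * (40 * (8 * J * \<tau>)) < vol \<tau> ^ 3" if L: "L0 \<le> L" for L
  proof -
    have L1: "112 \<le> L" "8 * J \<le> L" "A * D \<le> L" "B \<le> L" using L unfolding L0_def by linarith+
    define X where "X = L ^ g"
    have LX: "L * L \<le> X"
      using g L1 power_increasing[of 2 g L] unfolding X_def by (simp add: power2_eq_square)
    then have "L \<le> X" using L1 by (meson le_square order_trans)
    then have "A * m ^ (2 * e + 1) \<le> X" using L1 unfolding D_def by simp
    from ex_doubling_scale[OF m2 this] obtain j where
      j: "m ^ j \<le> X" "vol (m ^ Suc j * X) \<le> D * vol (m ^ j * X)" unfolding D_def by blast
    define \<tau> where "\<tau> = m ^ j * X"
    have mj: "1 \<le> m ^ j" using m2 by simp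
    have X\<tau>: "X \<le> \<tau>" using mj unfolding \<tau>_def by simp
    have tau_pos: "0 < \<tau>" using X\<tau> \<open>L \<le> X\<close> L1 by linarith
    have 1: "112 * L \<le> \<tau>"
      using mult_le_mono1[OF L1(1), of L] LX X\<tau> by linarith
    have "8 * J * \<tau> \<le> L * (X * X)"
      using L1(2) j(1) unfolding \<tau>_def by (intro mult_le_mono) auto
    also have "\<dots> = L ^ G" unfolding X_def G_def by (simp add: power_add mult_2)
    finally have 2: "8 * J * \<tau> \<le> L ^ G" .
    have m\<tau>: "40 * (8 * J * \<tau>) = m * \<tau>" unfolding m_def by simp
    have vm: "vol (m * \<tau>) \<le> D * vol \<tau>" using j(2) unfolding \<tau>_def by (simp add: mult.assoc)
    have lower: "K * L ^ e * \<tau> < vol \<tau>"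
    proof -
      have Lpos: "0 < real L" using L1 by simp
      have "real L ^ (e + 1) = real L powr (real e + 1)"
        using Lpos by (simp add: powr_add powr_realpow)
      also have "\<dots> \<le> real L powr (real g * (\<delta> - 1))" using g L1 by (intro powr_mono) auto
      also have "\<dots> = real X powr (\<delta> - 1)"
        unfolding X_def using Lpos by (simp add: powr_powr[symmetric] powr_realpow)
      also have "\<dots> \<le> real \<tau> powr (\<delta> - 1)" using X\<tau> delta_gt_1 by (intro powr_mono2) auto
      finally have *: "real L ^ (e + 1) \<le> real \<tau> powr (\<delta> - 1)" .
      have "real K < c * real L"
      proof -
        have "real K / c < real L" using B L1(4) by simp
        then show ?thesis using c_pos by (simp add: pos_divide_less_eq mult.commute)
      qed
      then have "real K * real L ^ e * real \<tau> < c * real L * real L ^ e * real \<tau>"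
        using Lpos tau_pos by simp
      also have "\<dots> = c * real \<tau> * real L ^ (e + 1)" by simp
      also have "\<dots> \<le> c * real \<tau> * real \<tau> powr (\<delta> - 1)"
        using * c_pos by (intro mult_left_mono) auto
      also have "\<dots> = c * real \<tau> powr \<delta>"
        using tau_pos by (simp add: powr_diff)
      also have "\<dots> \<le> real (vol \<tau>)" using tau_pos by (intro vol_lower) simp
      finally have "real (K * L ^ e * \<tau>) < real (vol \<tau>)" by simp
      then show ?thesis by (simp only: of_nat_less_iff)
    qed
    have "vol (112 * L) \<le> A * (112 * L) ^ e" using L1 by (intro vol_upper) simp
    then have "J * vol (112 * L) * (vol (m * \<tau>))\<^sup>2 * (m * \<tau>)
        \<le> J * (A * (112 * L) ^ e) * (D * vol \<tau>)\<^sup>2 * (m * \<tau>)"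
      using vm by (intro mult_le_mono power_mono order_refl) auto
    also have "\<dots> = K * L ^ e * \<tau> * (vol \<tau>)\<^sup>2"
      unfolding K_def by (simp add: power_mult_distrib mult_ac)
    also have "\<dots> < vol \<tau> * (vol \<tau>)\<^sup>2"
      using lower vol_pos[of \<tau>] by (intro mult_strict_right_mono) auto
    also have "\<dots> = vol \<tau> ^ 3" by (simp add: power3_eq_cube power2_eq_square)
    finally have 3: "J * vol (112 * L) * (vol (40 * (8 * J * \<tau>)))\<^sup>2 * (40 * (8 * J * \<tau>)) < vol \<tau> ^ 3"
      unfolding m\<tau> .
    show ?thesis using 1 2 3 by blast
  qed
  moreover have "0 < G" "0 < L0" unfolding G_def L0_def by auto
  ultimately show ?thesis unfolding J_def by blast
qed

end

section \<open>Percolation events with finite support\<close>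

context transitive_graph
begin

abbreviation "perc p \<equiv> site_percolation V p"

lemma prob_space_perc: "prob_space (perc p)"
  unfolding site_percolation_def by (intro prob_space_PiM prob_space_measure_pmf)

lemma sets_PiM_pmf_finite:
  assumes "finite K"
  shows "sets (\<Pi>\<^sub>M x\<in>K. measure_pmf (bernoulli_pmf p)) = Pow (K \<rightarrow>\<^sub>E UNIV)"
proof -
  have "sets (\<Pi>\<^sub>M x\<in>K. measure_pmf (bernoulli_pmf p)) = sets (\<Pi>\<^sub>M x\<in>K. count_space (UNIV :: bool set))"
    by (intro sets_PiM_cong) auto
  also have "\<dots> = Pow (K \<rightarrow>\<^sub>E UNIV)"
    using assms by (subst count_space_PiM_finite) auto
  finally show ?thesis .
qed

text \<open>A finite product of discrete spaces is discrete, so \<open>Q\<close> may be any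
  predicate.\<close>

lemma finite_support_measurable:
  assumes "finite K" "K \<subseteq> V"
  shows "{\<omega> \<in> space (perc p). Q (restrict \<omega> K)} \<in> sets (perc p)"
proof -
  let ?N = "\<Pi>\<^sub>M x\<in>K. measure_pmf (bernoulli_pmf p)"
  have "(\<lambda>\<omega>. restrict \<omega> K) \<in> perc p \<rightarrow>\<^sub>M ?N"
    unfolding site_percolation_def using assms(2) by (rule measurable_restrict_subset)
  moreover have "{\<eta> \<in> space ?N. Q \<eta>} \<in> sets ?N"
    using sets_PiM_pmf_finite[OF assms(1)] by (auto simp: space_PiM)
  ultimately have "(\<lambda>\<omega>. restrict \<omega> K) -` {\<eta> \<in> space ?N. Q \<eta>} \<inter> space (perc p) \<in> sets (perc p)"
    by (rule measurable_sets)
  also have "(\<lambda>\<omega>. restrict \<omega> K) -` {\<eta> \<in> space ?N. Q \<eta>} \<inter> space (perc p) = {\<omega> \<in> space (perc p). Q (restrict \<omega> K)}"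
    by (auto simp: space_PiM)
  finally show ?thesis .
qed

text \<open>The coordinates of a product measure are independent, and so are their restrictions to
  disjoint blocks.\<close>

lemma finite_support_indep:
  assumes F: "finite F" "F \<noteq> {}" and K: "\<And>y. y \<in> F \<Longrightarrow> finite (K y)" "\<And>y. y \<in> F \<Longrightarrow> K y \<subseteq> V"
    and disj: "disjoint_family_on K F"
  shows "measure (perc p) (\<Inter>y\<in>F. {\<omega> \<in> space (perc p). Q y (restrict \<omega> (K y))})
    = (\<Prod>y\<in>F. measure (perc p) {\<omega> \<in> space (perc p). Q y (restrict \<omega> (K y))})"
proof -
  interpret prob_space "perc p" by (rule prob_space_perc)
  let ?B = "\<lambda>_ :: 'v. measure_pmf (bernoulli_pmf p)"
  have rv: "(\<lambda>\<omega>. \<omega> x) \<in> perc p \<rightarrow>\<^sub>M ?B x" if "x \<in> V" for x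
    unfolding site_percolation_def using that by (rule measurable_component_singleton)
  \<comment> \<open>The criterion for independence: the joint law of the coordinates is the product
    of their marginal laws.\<close>
  have "distr (perc p) (Pi\<^sub>M V ?B) (\<lambda>\<omega>. \<lambda>x\<in>V. \<omega> x) = distr (perc p) (perc p) (\<lambda>\<omega>. \<omega>)"
    by (intro distr_cong) (auto simp: site_percolation_def space_PiM)
  also have "\<dots> = Pi\<^sub>M V ?B" by (simp add: distr_id2 site_percolation_def)
  also have "\<dots> = Pi\<^sub>M V (\<lambda>x. distr (perc p) (?B x) (\<lambda>\<omega>. \<omega> x))"
    unfolding site_percolation_def
    by (intro PiM_cong refl distr_PiM_component[symmetric] prob_space_measure_pmf) auto
  finally have dist: "distr (perc p) (Pi\<^sub>M V ?B) (\<lambda>\<omega>. \<lambda>x\<in>V. \<omega> x)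
      = Pi\<^sub>M V (\<lambda>x. distr (perc p) (?B x) (\<lambda>\<omega>. \<omega> x))" .
  have "indep_vars ?B (\<lambda>x \<omega>. \<omega> x) V"
    using indep_vars_iff_distr_eq_PiM'[of V "\<lambda>x \<omega>. \<omega> x" ?B] verts_nonempty rv dist by blast
  from indep_vars_restrict[OF this K(2) disj]
  have ind: "indep_vars (\<lambda>y. Pi\<^sub>M (K y) ?B) (\<lambda>y \<omega>. restrict \<omega> (K y)) F" by simp
  let ?A = "\<lambda>y. {\<eta> \<in> space (Pi\<^sub>M (K y) ?B). Q y \<eta>}"
  have "?A y \<in> sets (Pi\<^sub>M (K y) ?B)" if "y \<in> F" for y
    using sets_PiM_pmf_finite[OF K(1)[OF that]] by (auto simp: space_PiM)
  from indep_varsD_finite[OF ind F(2,1) this]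
  have "prob (\<Inter>y\<in>F. (\<lambda>\<omega>. restrict \<omega> (K y)) -` ?A y \<inter> space (perc p))
    = (\<Prod>y\<in>F. prob ((\<lambda>\<omega>. restrict \<omega> (K y)) -` ?A y \<inter> space (perc p)))" by simp
  moreover have eq: "(\<lambda>\<omega>. restrict \<omega> (K y)) -` ?A y \<inter> space (perc p) = {\<omega> \<in> space (perc p). Q y (restrict \<omega> (K y))}" for y
    by (auto simp: space_PiM)
  ultimately show ?thesis by (simp only: eq)
qed

lemma prob_closed_vertex:
  assumes "x \<in> V" "0 \<le> p" "p \<le> 1"
  shows "measure (perc p) {\<omega> \<in> space (perc p). \<not> \<omega> x} = 1 - p"
proof -
  interpret product_prob_space "\<lambda>_ :: 'v. measure_pmf (bernoulli_pmf p)" V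
    by unfold_locales
  have "emeasure (perc p) {\<omega> \<in> space (perc p). \<omega> x \<in> {False}} = emeasure (measure_pmf (bernoulli_pmf p)) {False}"
    unfolding site_percolation_def using assms(1) by (intro emeasure_PiM_Collect_single) auto
  also have "\<dots> = ennreal (1 - p)" using assms by (simp add: emeasure_pmf_single)
  finally show ?thesis using assms by (simp add: measure_def)
qed

section \<open>Probabilities of bad vertices\<close>

definition bad_event :: "real \<Rightarrow> nat \<Rightarrow> 'v \<Rightarrow> ('v \<Rightarrow> bool) set" where
  "bad_event p L x = {\<omega> \<in> space (perc p). \<not> good L (open_vertices V \<omega>) x}"

lemma bad_event_support:
  "bad_event p L x = {\<omega> \<in> space (perc p). \<not> good L (open_vertices V (restrict \<omega> (gball x (56 * L)))) x}"
proof -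
  have "good L (open_vertices V \<omega>) x \<longleftrightarrow> good L (open_vertices V (restrict \<omega> (gball x (56 * L)))) x" for \<omega>
    by (rule good_cong) (auto simp: open_vertices_def)
  then show ?thesis unfolding bad_event_def by blast
qed

lemma bad_event_measurable [measurable]: "x \<in> V \<Longrightarrow> bad_event p L x \<in> sets (perc p)"
  unfolding bad_event_support by (intro finite_support_measurable finite_ball ball_subset_verts)

lemma bad_event_indep:
  assumes F: "finite F" "F \<noteq> {}" "F \<subseteq> V" and sep: "\<And>y z. y \<in> F \<Longrightarrow> z \<in> F \<Longrightarrow> y \<noteq> z \<Longrightarrow> 112 * L < d y z"
  shows "measure (perc p) (\<Inter>y\<in>F. bad_event p L y) = (\<Prod>y\<in>F. measure (perc p) (bad_event p L y))"
  unfolding bad_event_support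
proof (rule finite_support_indep[OF F(1,2)])
  show "disjoint_family_on (\<lambda>y. gball y (56 * L)) F"
    unfolding disjoint_family_on_def
  proof (intro ballI impI, rule ccontr)
    fix y z assume yz: "y \<in> F" "z \<in> F" "y \<noteq> z" and "gball y (56 * L) \<inter> gball z (56 * L) \<noteq> {}"
    then obtain w where w: "w \<in> gball y (56 * L)" "w \<in> gball z (56 * L)" by blast
    have V: "y \<in> V" "z \<in> V" using yz F by auto
    have "w \<in> V" "d y w \<le> 56 * L" "d z w \<le> 56 * L" using w V by (auto simp: mem_gball)
    then show False using d_triangle[OF V(1) \<open>w \<in> V\<close> V(2)] d_sym[OF V(2) \<open>w \<in> V\<close>] sep[OF yz] by simp
  qed
qed (use F finite_ball ball_subset_verts in auto)

text \<open>A union bound over the possible sets of \<open>J\<close> separated bad vertices: there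
  are at most \<open>vol (55 * R) ^ J\<close> of them, and independence gives each probability at
  most \<open>\<epsilon> ^ J\<close>.\<close>

lemma prob_bad_next_scale:
  assumes L: "0 < L" "112 * L \<le> \<tau>" and J: "0 < J" and R: "R = 8 * J * \<tau>"
    and small: "J * vol (112 * L) * (vol (40 * R))\<^sup>2 * (40 * R) < vol \<tau> ^ 3"
    and eps: "\<And>y. y \<in> V \<Longrightarrow> measure (perc p) (bad_event p L y) \<le> \<epsilon>"
    and x: "x \<in> V"
  shows "measure (perc p) (bad_event p R x) \<le> real (vol (55 * R)) ^ J * \<epsilon> ^ J"
proof -
  interpret prob_space "perc p" by (rule prob_space_perc)
  \<comment> \<open>Badness is left out, so that this index set does not depend on the
    configuration.\<close>
  define FF where "FF = {F. F \<subseteq> gball x (55 * R) \<and> card F = J \<and> (\<forall>y\<in>F. \<forall>z\<in>F. y \<noteq> z \<longrightarrow> 112 * L < d y z)}"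
  have eps0: "0 \<le> \<epsilon>" using eps[OF x] measure_nonneg order_trans by blast
  have FF: "F \<subseteq> V" "finite F" "F \<noteq> {}" "card F = J" if "F \<in> FF" for F
  proof -
    have *: "F \<subseteq> gball x (55 * R)" "card F = J" using that by (auto simp: FF_def)
    then show "F \<subseteq> V" "card F = J" "F \<noteq> {}" using ball_subset_verts J by auto
    show "finite F" using *(1) finite_ball[OF x] by (rule finite_subset)
  qed
  have sub: "FF \<subseteq> {F. F \<subseteq> gball x (55 * R) \<and> card F = J}" unfolding FF_def by auto
  have finS: "finite {F. F \<subseteq> gball x (55 * R) \<and> card F = J}" using finite_ball[OF x] by simp
  have finFF: "finite FF" using sub finS by (rule finite_subset)
  have "card FF \<le> card {F. F \<subseteq> gball x (55 * R) \<and> card F = J}" by (rule card_mono[OF finS sub])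
  also have "\<dots> = vol (55 * R) choose J" using n_subsets[OF finite_ball[OF x]] card_ball[OF x] by simp
  also have "\<dots> \<le> vol (55 * R) ^ J"
    by (cases "J \<le> vol (55 * R)") (auto intro: binomial_le_pow simp: binomial_eq_0)
  finally have cardFF: "card FF \<le> vol (55 * R) ^ J" .
  have meas: "(\<Inter>y\<in>F. bad_event p L y) \<in> events" if "F \<in> FF" for F
    using FF[OF that] by (intro sets.finite_INT) auto
  have "bad_event p R x \<subseteq> (\<Union>F\<in>FF. \<Inter>y\<in>F. bad_event p L y)"
  proof
    fix \<omega> assume "\<omega> \<in> bad_event p R x"
    then have \<omega>: "\<omega> \<in> space (perc p)" "\<not> good R (open_vertices V \<omega>) x" by (auto simp: bad_event_def)
    have "open_vertices V \<omega> \<subseteq> V" by (auto simp: open_vertices_def)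
    from separated_bad_vertices[OF x this L J R small \<omega>(2)]
    obtain F where F: "F \<subseteq> gball x (55 * R)" "card F = J" "\<forall>y\<in>F. \<not> good L (open_vertices V \<omega>) y"
      "\<forall>y\<in>F. \<forall>z\<in>F. y \<noteq> z \<longrightarrow> 112 * L < d y z" by auto
    then have "F \<in> FF" by (simp add: FF_def)
    then show "\<omega> \<in> (\<Union>F\<in>FF. \<Inter>y\<in>F. bad_event p L y)" using \<omega>(1) F(3) by (auto simp: bad_event_def)
  qed
  then have "prob (bad_event p R x) \<le> prob (\<Union>F\<in>FF. \<Inter>y\<in>F. bad_event p L y)"
    using meas finFF by (intro finite_measure_mono) auto
  also have "\<dots> \<le> (\<Sum>F\<in>FF. prob (\<Inter>y\<in>F. bad_event p L y))"
    using meas finFF by (intro finite_measure_subadditive_finite) auto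
  also have "\<dots> \<le> (\<Sum>F\<in>FF. \<epsilon> ^ J)"
  proof (rule sum_mono)
    fix F assume F: "F \<in> FF"
    have "prob (\<Inter>y\<in>F. bad_event p L y) = (\<Prod>y\<in>F. prob (bad_event p L y))"
      using F FF[OF F] by (intro bad_event_indep) (auto simp: FF_def)
    also have "\<dots> \<le> (\<Prod>y\<in>F. \<epsilon>)" using FF[OF F] eps by (intro prod_mono) auto
    also have "\<dots> = \<epsilon> ^ J" using FF[OF F] by simp
    finally show "prob (\<Inter>y\<in>F. bad_event p L y) \<le> \<epsilon> ^ J" .
  qed
  also have "\<dots> = real (card FF) * \<epsilon> ^ J" by simp
  also have "\<dots> \<le> real (vol (55 * R) ^ J) * \<epsilon> ^ J"
    using cardFF eps0 by (intro mult_right_mono) auto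
  finally show ?thesis by simp
qed

lemma prob_bad_base:
  assumes "x \<in> V" "0 < L" "0 \<le> p" "p \<le> 1"
  shows "measure (perc p) (bad_event p L x) \<le> real (vol (56 * L)) * (1 - p)"
proof -
  interpret prob_space "perc p" by (rule prob_space_perc)
  let ?C = "\<lambda>v. {\<omega> \<in> space (perc p). \<not> \<omega> v}"
  have C: "?C v \<in> events" if "v \<in> V" for v
    using finite_support_measurable[of "{v}" p "\<lambda>\<eta>. \<not> \<eta> v"] that by simp
  have V: "gball x (56 * L) \<subseteq> V" by (rule ball_subset_verts)
  have "bad_event p L x \<subseteq> (\<Union>v\<in>gball x (56 * L). ?C v)"
  proof
    fix \<omega> assume "\<omega> \<in> bad_event p L x"
    then have \<omega>: "\<omega> \<in> space (perc p)" "\<not> gball x (56 * L) \<subseteq> open_vertices V \<omega>"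
      using good_if_ball_subset[OF assms(1,2)] by (auto simp: bad_event_def)
    then show "\<omega> \<in> (\<Union>v\<in>gball x (56 * L). ?C v)" using V by (auto simp: open_vertices_def)
  qed
  then have "prob (bad_event p L x) \<le> prob (\<Union>v\<in>gball x (56 * L). ?C v)"
    using C V finite_ball[OF assms(1)] by (intro finite_measure_mono sets.finite_UN) auto
  also have "\<dots> \<le> (\<Sum>v\<in>gball x (56 * L). prob (?C v))"
    using C V finite_ball[OF assms(1)] by (intro finite_measure_subadditive_finite) auto
  also have "\<dots> = (\<Sum>v\<in>gball x (56 * L). 1 - p)"
    using V assms by (intro sum.cong prob_closed_vertex refl) auto
  finally show ?thesis using card_ball[OF assms(1)] by simp
qed

end

section \<open>Infinite clusters\<close>

context transitive_graph
begin

lemma countable_verts: "countable V"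
proof -
  obtain x where x: "x \<in> V" using verts_nonempty by auto
  have "V \<subseteq> (\<Union>n. gball x n)" using x by (auto simp: mem_gball)
  moreover have "countable (\<Union>n. gball x n)"
    using finite_ball[OF x] by (intro countable_UN) (auto intro: countable_finite)
  ultimately show ?thesis by (rule countable_subset)
qed

lemma clusters_eq: "clusters V E \<omega> = {{w. linked (open_vertices V \<omega>) u w} | u. u \<in> open_vertices V \<omega>}"
proof -
  let ?O = "open_vertices V \<omega>"
  have OV: "?O \<subseteq> V" by (auto simp: open_vertices_def)
  have "w \<in> ?O \<and> (\<exists>xs. walk ?O (induced_edges E ?O) u xs w) \<longleftrightarrow> linked ?O u w" for u w
  proof
    assume "w \<in> ?O \<and> (\<exists>xs. walk ?O (induced_edges E ?O) u xs w)"
    then obtain xs where xs: "walk ?O (induced_edges E ?O) u xs w" by blast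
    moreover have "set xs \<subseteq> ?O" using xs by (simp add: walk_def)
    ultimately show "linked ?O u w" by (intro walk_linked[OF xs]) (auto simp: induced_edges_def)
  next
    assume "linked ?O u w"
    then show "w \<in> ?O \<and> (\<exists>xs. walk ?O (induced_edges E ?O) u xs w)"
      using linked_walk[OF _ OV] linked_in by blast
  qed
  then show ?thesis unfolding clusters_def graph_components_def by simp
qed

lemma infinite_cluster_iff:
  "(\<exists>C\<in>clusters V E \<omega>. infinite C) \<longleftrightarrow> (\<exists>u\<in>V. infinite {w. linked (open_vertices V \<omega>) u w})"
proof -
  have "u \<in> open_vertices V \<omega>" if "infinite {w. linked (open_vertices V \<omega>) u w}" for u
  proof (rule ccontr)
    assume "u \<notin> open_vertices V \<omega>"
    then have "{w. linked (open_vertices V \<omega>) u w} = {}" using linked_in by blast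
    with that show False by simp
  qed
  moreover have "open_vertices V \<omega> \<subseteq> V" by (auto simp: open_vertices_def)
  ultimately show ?thesis unfolding clusters_eq by blast
qed

lemma linked_bounded:
  assumes "linked S u w" "S \<subseteq> V"
  shows "\<exists>n. linked (S \<inter> gball u n) u w"
  using assms(1)
proof (induction rule: linked_induct)
  case refl
  then have "u \<in> S \<inter> gball u 0" using assms(2) by (auto simp: mem_gball)
  then show ?case using linked_refl by blast
next
  case (step y z)
  have u: "u \<in> V" using linked_in[OF assms(1)] assms(2) by blast
  from step obtain n where n: "linked (S \<inter> gball u n) u y" by blast
  define m where "m = n + d u y + d u z"
  have "y \<in> S \<inter> gball u m" "z \<in> S \<inter> gball u m"
    using step assms(2) u unfolding m_def by (auto simp: mem_gball)
  then have "linked (S \<inter> gball u m) y z" using step by (intro linked_edge)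
  moreover have "linked (S \<inter> gball u m) u y"
    using ball_mono[of n m u] unfolding m_def by (intro linked_mono[OF n]) auto
  ultimately have "linked (S \<inter> gball u m) u z" by (rule linked_trans[rotated])
  then show ?case by blast
qed

text \<open>Expresses infinitude by countable quantifiers over conditions on finitely many vertices,
  as needed for measurability.\<close>

lemma infinite_linked_iff:
  assumes "u \<in> V" "S \<subseteq> V"
  shows "infinite {w. linked S u w} \<longleftrightarrow> (\<forall>n. \<exists>w\<in>V - gball u n. \<exists>m. linked (S \<inter> gball u m) u w)"
proof
  assume inf: "infinite {w. linked S u w}"
  show "\<forall>n. \<exists>w\<in>V - gball u n. \<exists>m. linked (S \<inter> gball u m) u w"
  proof
    fix n
    have "\<not> {w. linked S u w} \<subseteq> gball u n" using inf finite_subset[OF _ finite_ball[OF assms(1)]] by blast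
    then obtain w where w: "linked S u w" "w \<notin> gball u n" by blast
    have "w \<in> V" using linked_in[OF w(1)] assms(2) by blast
    then show "\<exists>w\<in>V - gball u n. \<exists>m. linked (S \<inter> gball u m) u w"
      using w linked_bounded[OF w(1) assms(2)] by blast
  qed
next
  assume *: "\<forall>n. \<exists>w\<in>V - gball u n. \<exists>m. linked (S \<inter> gball u m) u w"
  show "infinite {w. linked S u w}"
  proof
    assume fin: "finite {w. linked S u w}"
    define n where "n = Max (d u ` {w. linked S u w})"
    from * obtain w m where w: "w \<in> V - gball u n" "linked (S \<inter> gball u m) u w" by blast
    have lw: "linked S u w" using linked_mono[OF w(2)] by blast
    then have "d u w \<le> n" unfolding n_def using fin by (intro Max_ge) auto
    then show False using w assms(1) by (simp add: mem_gball)
  qed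
qed

definition infinite_event :: "real \<Rightarrow> ('v \<Rightarrow> bool) set" where
  "infinite_event p = {\<omega> \<in> space (perc p). \<exists>C\<in>clusters V E \<omega>. infinite C}"

text \<open>Without this, a lower bound on the probability of an included event would say nothing
  about \<open>measure\<close>, which is 0 on non-measurable sets.\<close>

lemma infinite_event_measurable: "infinite_event p \<in> sets (perc p)"
proof -
  have "{\<omega> \<in> space (perc p). linked (open_vertices V \<omega> \<inter> gball u m) u w} \<in> sets (perc p)" if "u \<in> V" for u m w
  proof -
    have eq: "open_vertices V \<omega> \<inter> gball u m = open_vertices V (restrict \<omega> (gball u m)) \<inter> gball u m" for \<omega>
      by (auto simp: open_vertices_def)
    have "{\<omega> \<in> space (perc p). linked (open_vertices V (restrict \<omega> (gball u m)) \<inter> gball u m) u w} \<in> sets (perc p)"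
      using that by (intro finite_support_measurable finite_ball ball_subset_verts)
    then show ?thesis by (subst eq)
  qed
  then have "{\<omega> \<in> space (perc p). \<exists>u\<in>V. \<forall>n. \<exists>w\<in>V - gball u n. \<exists>m.
      linked (open_vertices V \<omega> \<inter> gball u m) u w} \<in> sets (perc p)"
    using countable_verts
    by (intro sets.sets_Collect_countable_Ex' sets.sets_Collect_countable_All sets.sets_Collect_countable_Ex) auto
  moreover have "(\<exists>C\<in>clusters V E \<omega>. infinite C) \<longleftrightarrow>
      (\<exists>u\<in>V. \<forall>n. \<exists>w\<in>V - gball u n. \<exists>m. linked (open_vertices V \<omega> \<inter> gball u m) u w)" for \<omega>
    unfolding infinite_cluster_iff
    by (intro bex_cong refl infinite_linked_iff) (auto simp: open_vertices_def)
  ultimately show ?thesis unfolding infinite_event_def by simp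
qed

lemma critical_probability_eq:
  "critical_probability V E = Sup {p \<in> {0..1}. measure (perc p) (infinite_event p) = 0}"
  unfolding critical_probability_def infinite_event_def by simp

text \<open>Makes the set in \<open>critical_probability_eq\<close> nonempty, so that its supremum
  can be bounded.\<close>

lemma infinite_event_0: "measure (perc 0) (infinite_event 0) = 0"
proof -
  interpret prob_space "perc 0" by (rule prob_space_perc)
  have "AE \<omega> in perc 0. \<not> \<omega> v" if "v \<in> V" for v
  proof -
    have "{\<omega> \<in> space (perc 0). \<not> \<omega> v} \<in> events"
      using finite_support_measurable[of "{v}" 0 "\<lambda>\<eta>. \<not> \<eta> v"] that by simp
    from prob_Collect_eq_1[OF this] show ?thesis using prob_closed_vertex[OF that, of 0] by simp
  qed
  then have "AE \<omega> in perc 0. \<forall>v\<in>V. \<not> \<omega> v" using countable_verts by (simp add: AE_ball_countable)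
  then have "AE \<omega> in perc 0. \<omega> \<notin> infinite_event 0"
  proof (rule AE_mp, intro AE_I2 impI)
    fix \<omega> assume "\<forall>v\<in>V. \<not> \<omega> v"
    then have "open_vertices V \<omega> = {}" by (auto simp: open_vertices_def)
    then show "\<omega> \<notin> infinite_event 0" by (simp add: infinite_event_def clusters_eq)
  qed
  then show ?thesis using prob_eq_0[OF infinite_event_measurable] by simp
qed

text \<open>Near \<open>x\<close> there is a long connection at every scale. Goodness at scale
  \<open>L k\<close> of all vertices around links the connections of scales \<open>L k\<close> and
  \<open>L (Suc k)\<close>, so one cluster contains pairs of vertices arbitrarily far apart.\<close>

lemma infinite_linked_of_good:
  fixes L :: "nat \<Rightarrow> nat"
  assumes x: "x \<in> V" and S: "S \<subseteq> V" and L: "\<And>k. 2 ^ k \<le> L k" "\<And>k. L k \<le> L (Suc k)"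
    and good: "\<And>k y. y \<in> gball x (17 * L (Suc k)) \<Longrightarrow> good (L k) S y"
  shows "\<exists>u. infinite {w. linked S u w}"
proof -
  have Lpos: "0 < L k" for k using L(1)[of k] by (meson order_less_le_trans pos2 zero_less_power)
  have "\<exists>u. long_from (L k) S x u" for k
    using good_ex_long[OF good[of x k]] x by (simp add: mem_gball)
  then obtain u where u: "\<And>k. long_from (L k) S x (u k)" by metis
  then obtain v where v: "\<And>k. linked (S \<inter> gball x (17 * L k)) (u k) (v k)" "\<And>k. L k \<le> d (u k) (v k)"
    unfolding long_from_def by metis
  have step: "linked S (u k) (u (Suc k))" for k
  proof -
    let ?S = "S \<inter> gball x (17 * L (Suc k))" and ?a = "u (Suc k)"
    have SV: "?S \<subseteq> V" using S by auto
    \<comment> \<open>Cutting the connection of scale \<open>L (Suc k)\<close> at length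
      \<open>L k\<close> makes it comparable with the other one at scale \<open>L k\<close>.\<close>
    have "L k \<le> d ?a (v (Suc k))" using v(2)[of "Suc k"] L(2)[of k] by simp
    from linked_at_distance[OF v(1) SV this]
    obtain w where w: "linked (?S \<inter> gball ?a (L k)) ?a w" "d ?a w = L k" by blast
    have "long_from (L k) S ?a ?a" by (rule long_from_self[OF linked_mono[OF w(1)] w(2)]) blast
    moreover have "?a \<in> gball x (17 * L (Suc k))" using linked_in[OF v(1)] by blast
    ultimately have "linked (S \<inter> (\<Union>z\<in>gball x (17 * L (Suc k)). gball z (56 * L k))) (u k) ?a"
      using linked_of_good_chain[OF Lpos linked_ball[OF x] ball_subset_verts good u] by blast
    then show ?thesis by (elim linked_mono) blast
  qed
  have u0: "linked S (u 0) (u k)" for k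
  proof (induction k)
    case 0
    show ?case using linked_in[OF v(1)[of 0]] by (intro linked_refl) blast
  next
    case (Suc k)
    then show ?case using step linked_trans by blast
  qed
  have v0: "linked S (u 0) (v k)" for k
    using linked_trans[OF u0 linked_mono[OF v(1)[of k]]] by blast
  have "infinite {w. linked S (u 0) w}"
  proof
    assume fin: "finite {w. linked S (u 0) w}"
    define n where "n = Max (d (u 0) ` {w. linked S (u 0) w})"
    have n: "d (u 0) w \<le> n" if "linked S (u 0) w" for w
      unfolding n_def using fin that by (intro Max_ge) auto
    have V: "u k \<in> V" "v k \<in> V" for k using linked_in[OF u0] linked_in[OF v0] S by auto
    \<comment> \<open>At index \<open>2 * n\<close> the two ends are more than \<open>2 * n\<close>
      apart, although both are within \<open>n\<close> of \<open>u 0\<close>.\<close>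
    have "2 * n < 2 ^ (2 * n)" by (rule less_exp)
    also have "\<dots> \<le> d (u (2 * n)) (v (2 * n))" using L(1) v(2) order_trans by blast
    also have "\<dots> \<le> d (u 0) (u (2 * n)) + d (u 0) (v (2 * n))"
      using d_triangle[OF V(1)[of "2 * n"] V(1)[of 0] V(2)[of "2 * n"]] d_sym[OF V(1) V(1), of "2 * n" 0] by simp
    also have "\<dots> \<le> n + n" by (intro add_mono n u0 v0)
    finally show False by simp
  qed
  then show ?thesis by blast
qed

end

section \<open>The multiscale induction\<close>

context growing_graph
begin

text \<open>The scales and the exponent \<open>b\<close> do not depend on \<open>p\<close>; hence
  only the first scale will restrict \<open>p\<close>. The third clause prepares the union bound
  over all vertices that must be good at scale \<open>L k\<close>.\<close>

lemma ex_scales: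
  "\<exists>b L. (\<forall>k. 2 ^ (k + 2) \<le> L k) \<and> (\<forall>k. 0 < L k \<and> L k \<le> L (Suc k)) \<and>
     (\<forall>k. real A * (17 * real (L (Suc k))) ^ e * (1 / real (L k) ^ b) \<le> 1 / real (L k)) \<and>
     (\<forall>p k. (\<forall>x\<in>V. measure (perc p) (bad_event p (L k) x) \<le> 1 / real (L k) ^ b) \<longrightarrow>
        (\<forall>x\<in>V. measure (perc p) (bad_event p (L (Suc k)) x) \<le> 1 / real (L (Suc k)) ^ b))"
proof -
  obtain G L0 where G: "0 < G" and ex: "\<And>L. L0 \<le> L \<Longrightarrow> \<exists>\<tau>. 112 * L \<le> \<tau> \<and> 8 * (2 * G) * \<tau> \<le> L ^ G \<and>
     2 * G * vol (112 * L) * (vol (40 * (8 * (2 * G) * \<tau>)))\<^sup>2 * (40 * (8 * (2 * G) * \<tau>)) < vol \<tau> ^ 3"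
    using ex_next_scale by blast
  define J where "J = 2 * G"
  \<comment> \<open>Solves \<open>G * (1 + e * J + b) = b * J\<close>. In \<open>recursion\<close>,
    the terms on the left are the exponents of \<open>L k\<close> bounding \<open>C ^ J\<close>, the
    volume factor and the inverse of the target bound; the right side is the gain from
    independence.\<close>
  define b where "b = 2 * G * e + 1"
  define C where "C = A * 55 ^ e"
  \<comment> \<open>The 4 starts the bound \<open>2 ^ (k + 2)\<close>, and the square of
    \<open>C\<close> ensures that \<open>C ^ J\<close> is at most \<open>L k ^ G\<close>.\<close>
  define L1 where "L1 = L0 + 4 + C\<^sup>2"
  define next_tau where "next_tau L = (SOME \<tau>. 112 * L \<le> \<tau> \<and> 8 * J * \<tau> \<le> L ^ G \<and>
     J * vol (112 * L) * (vol (40 * (8 * J * \<tau>)))\<^sup>2 * (40 * (8 * J * \<tau>)) < vol \<tau> ^ 3)" for L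
  have next_tau: "112 * L \<le> next_tau L" "8 * J * next_tau L \<le> L ^ G"
    "J * vol (112 * L) * (vol (40 * (8 * J * next_tau L)))\<^sup>2 * (40 * (8 * J * next_tau L)) < vol (next_tau L) ^ 3"
    if "L1 \<le> L" for L
    using someI_ex[OF ex[of L], folded J_def, folded next_tau_def] that unfolding L1_def by auto
  define L where "L k = ((\<lambda>L. 8 * J * next_tau L) ^^ k) L1" for k
  have L_Suc: "L (Suc k) = 8 * J * next_tau (L k)" for k unfolding L_def by simp
  have J0: "1 \<le> J" unfolding J_def using G by simp
  have grow: "2 * M \<le> 8 * J * next_tau M" if "L1 \<le> M" for M
  proof -
    have "2 * M \<le> 8 * next_tau M" using next_tau(1)[OF that] by linarith
    also have "\<dots> \<le> J * (8 * next_tau M)" using J0 by simp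
    finally show ?thesis by simp
  qed
  have L_ge: "L1 \<le> L k" for k
  proof (induction k)
    case (Suc k) then show ?case using grow[OF Suc] L_Suc[of k] by linarith
  qed (simp add: L_def)
  have double: "2 * L k \<le> L (Suc k)" for k using grow[OF L_ge] L_Suc by simp
  have L4: "4 \<le> L k" for k using L_ge[of k] unfolding L1_def by linarith
  have pow: "2 ^ (k + 2) \<le> L k" for k
  proof (induction k)
    case 0 then show ?case using L4[of 0] by simp
  next
    case (Suc k) then show ?case using double[of k] by simp
  qed
  have CL: "C\<^sup>2 \<le> L k" for k using L_ge[of k] unfolding L1_def by linarith
  have L_pow: "L (Suc k) \<le> L k ^ G" for k using next_tau(2)[OF L_ge] L_Suc by simp
  have Lr: "0 < real (L k)" for k using L4[of k] by simp
  have vol_le: "real (vol (55 * L k)) \<le> real C * real (L k) ^ e" for k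
  proof -
    have "vol (55 * L k) \<le> A * (55 * L k) ^ e" using L4[of k] by (intro vol_upper) simp
    also have "\<dots> = C * L k ^ e" by (simp add: C_def power_mult_distrib)
    finally show ?thesis by (metis of_nat_le_iff of_nat_mult of_nat_power)
  qed
  have recursion: "measure (perc p) (bad_event p (L (Suc k)) x) \<le> 1 / real (L (Suc k)) ^ b"
    if IH: "\<forall>x\<in>V. measure (perc p) (bad_event p (L k) x) \<le> 1 / real (L k) ^ b" and x: "x \<in> V" for p k x
  proof -
    let ?R = "real (L (Suc k))" and ?L = "real (L k)"
    have small: "J * vol (112 * L k) * (vol (40 * L (Suc k)))\<^sup>2 * (40 * L (Suc k)) < vol (next_tau (L k)) ^ 3"
      using next_tau(3)[OF L_ge] unfolding L_Suc .
    have Lk: "0 < L k" "0 < J" using L4[of k] J0 by auto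
    have "measure (perc p) (bad_event p (L (Suc k)) x) \<le> real (vol (55 * L (Suc k))) ^ J * (1 / ?L ^ b) ^ J"
      by (rule prob_bad_next_scale[OF Lk(1) next_tau(1)[OF L_ge] Lk(2) L_Suc small _ x]) (use IH in blast)
    also have "\<dots> \<le> (real C * ?R ^ e) ^ J * (1 / ?L ^ b) ^ J"
      using vol_le Lr by (intro mult_right_mono power_mono) auto
    also have "\<dots> = real C ^ J * ?R ^ (e * J) / ?L ^ (b * J)"
      by (simp add: power_mult_distrib power_mult power_divide)
    also have "\<dots> \<le> 1 / ?R ^ b"
    proof -
      have "C ^ J * L (Suc k) ^ (e * J) * L (Suc k) ^ b = (C\<^sup>2) ^ G * L (Suc k) ^ (e * J + b)"
        unfolding J_def by (simp add: power_mult power_add)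
      also have "\<dots> \<le> L k ^ G * (L k ^ G) ^ (e * J + b)"
        using CL L_pow by (intro mult_le_mono power_mono) auto
      also have "\<dots> = L k ^ (b * J)"
        by (simp add: power_mult[symmetric] power_add[symmetric] b_def J_def algebra_simps)
      finally have "real (C ^ J * L (Suc k) ^ (e * J) * L (Suc k) ^ b) \<le> real (L k ^ (b * J))"
        by (rule of_nat_mono)
      then have "real C ^ J * ?R ^ (e * J) * ?R ^ b \<le> ?L ^ (b * J)" by simp
      then show ?thesis using Lr by (simp add: field_simps)
    qed
    finally show ?thesis .
  qed
  have final: "real A * (17 * real (L (Suc k))) ^ e * (1 / real (L k) ^ b) \<le> 1 / real (L k)" for k
  proof -
    let ?R = "real (L (Suc k))" and ?L = "real (L k)"
    have "A * (17 * L (Suc k)) ^ e * L k \<le> (C * L k) * (L k ^ G) ^ e"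
    proof -
      have "A * (17 * L (Suc k)) ^ e * L k \<le> A * (55 * L k ^ G) ^ e * L k"
        using L_pow[of k] by (intro mult_le_mono power_mono) auto
      then show ?thesis unfolding C_def by (simp add: power_mult_distrib mult_ac)
    qed
    also have "\<dots> \<le> (L k * L k) * (L k ^ G) ^ e"
    proof (intro mult_le_mono1)
      have "C \<le> C\<^sup>2" by (simp add: power2_eq_square)
      then show "C \<le> L k" using CL[of k] by linarith
    qed
    also have "\<dots> = L k ^ (G * e + 2)" by (simp add: power_mult power_add power2_eq_square)
    also have "\<dots> \<le> L k ^ b"
    proof (rule power_increasing)
      have "1 \<le> G * e" using G e_pos by (simp add: Suc_le_eq)
      then show "G * e + 2 \<le> b" unfolding b_def by linarith
    qed (use L4[of k] in simp)
    finally have "real (A * (17 * L (Suc k)) ^ e * L k) \<le> real (L k ^ b)" by (rule of_nat_mono)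
    then have "real A * (17 * ?R) ^ e * ?L \<le> ?L ^ b" by simp
    then show ?thesis using Lr[of k] by (simp add: field_simps)
  qed
  have mono: "0 < L k \<and> L k \<le> L (Suc k)" for k using L4[of k] double[of k] by linarith
  show ?thesis
    by (rule exI[of _ b], rule exI[of _ L]) (use pow mono final recursion in blast)
qed

text \<open>With probability at least 1/2, no vertex needed in
  \<open>infinite_linked_of_good\<close> is bad at any scale. Treating all \<open>p\<close> between
  \<open>p0\<close> and 1 at once bounds the supremum without monotonicity in
  \<open>p\<close>.\<close>

lemma ex_supercritical:
  "\<exists>p0. 0 \<le> p0 \<and> p0 < 1 \<and> (\<forall>p. p0 \<le> p \<longrightarrow> p \<le> 1 \<longrightarrow> measure (perc p) (infinite_event p) \<noteq> 0)"
proof -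
  obtain b L where pow: "\<And>k. 2 ^ (k + 2) \<le> L k" and mono: "\<And>k. 0 < L k" "\<And>k. L k \<le> L (Suc k)"
    and final: "\<And>k. real A * (17 * real (L (Suc k))) ^ e * (1 / real (L k) ^ b) \<le> 1 / real (L k)"
    and rec: "\<And>p k. (\<forall>x\<in>V. measure (perc p) (bad_event p (L k) x) \<le> 1 / real (L k) ^ b) \<Longrightarrow>
        (\<forall>x\<in>V. measure (perc p) (bad_event p (L (Suc k)) x) \<le> 1 / real (L (Suc k)) ^ b)"
    using ex_scales by blast
  obtain x where x: "x \<in> V" using verts_nonempty by auto
  let ?v = "real (vol (56 * L 0))" and ?\<epsilon> = "1 / real (L 0) ^ b"
  \<comment> \<open>Makes the bound of \<open>prob_bad_base\<close> at scale \<open>L 0\<close> at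
    most \<open>1 / L 0 ^ b\<close>, which starts the recursion.\<close>
  define p0 where "p0 = max 0 (1 - ?\<epsilon> / ?v)"
  have v: "0 < ?v" using vol_pos by simp
  have eps: "0 < ?\<epsilon>" using mono(1) by simp
  have "measure (perc p) (infinite_event p) \<noteq> 0" if p: "p0 \<le> p" "p \<le> 1" for p
  proof -
    interpret prob_space "perc p" by (rule prob_space_perc)
    have p01: "0 \<le> p" "1 - p \<le> ?\<epsilon> / ?v" using p unfolding p0_def by auto
    have bad: "\<forall>x\<in>V. prob (bad_event p (L k) x) \<le> 1 / real (L k) ^ b" for k
    proof (induction k)
      case 0
      have "(1 - p) * ?v \<le> ?\<epsilon>" using p01(2) unfolding pos_le_divide_eq[OF v] .
      then have *: "?v * (1 - p) \<le> ?\<epsilon>" by (simp only: mult.commute)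
      show ?case using prob_bad_base[OF _ mono(1) p01(1) p(2), THEN order_trans, OF _ *] by blast
    qed (rule rec)
    define B where "B k = (\<Union>y\<in>gball x (17 * L (Suc k)). bad_event p (L k) y)" for k
    have yV: "y \<in> V" if "y \<in> gball x r" for y r using that ball_subset_verts by blast
    have B: "B k \<in> events" for k
      unfolding B_def using yV by (intro sets.finite_UN finite_ball[OF x] bad_event_measurable)
    have PB: "prob (B k) \<le> (1 / 2) ^ k * (1 / 4)" for k
    proof -
      have "prob (B k) \<le> (\<Sum>y\<in>gball x (17 * L (Suc k)). prob (bad_event p (L k) y))"
        unfolding B_def using yV
        by (intro finite_measure_subadditive_finite finite_ball[OF x]) auto
      also have "\<dots> \<le> (\<Sum>y\<in>gball x (17 * L (Suc k)). 1 / real (L k) ^ b)"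
        using bad yV by (intro sum_mono) blast
      also have "\<dots> = real (vol (17 * L (Suc k))) * (1 / real (L k) ^ b)"
        using card_ball[OF x] by simp
      also have "\<dots> \<le> real A * (17 * real (L (Suc k))) ^ e * (1 / real (L k) ^ b)"
      proof (rule mult_right_mono)
        have "vol (17 * L (Suc k)) \<le> A * (17 * L (Suc k)) ^ e"
          using mono(1)[of "Suc k"] by (intro vol_upper) simp
        then have "real (vol (17 * L (Suc k))) \<le> real (A * (17 * L (Suc k)) ^ e)" by (rule of_nat_mono)
        then show "real (vol (17 * L (Suc k))) \<le> real A * (17 * real (L (Suc k))) ^ e" by simp
      qed simp
      also have "\<dots> \<le> 1 / real (L k)" by (rule final)
      \<comment> \<open>The shift by 2 makes the sum over all scales 1/2 and not 2.\<close>
      also have "\<dots> \<le> 1 / 2 ^ (k + 2)"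
      proof (rule divide_left_mono)
        have "real (2 ^ (k + 2)) \<le> real (L k)" using pow by (rule of_nat_mono)
        then show "2 ^ (k + 2) \<le> real (L k)" by simp
      qed (use mono(1)[of k] in auto)
      also have "\<dots> = (1 / 2) ^ k * (1 / 4)" by (simp add: power_add power_divide)
      finally show ?thesis .
    qed
    have geo: "(\<lambda>k. (1 / 2 :: real) ^ k * (1 / 4)) sums (2 * (1 / 4))"
      using geometric_sums[of "1 / 2 :: real"] by (intro sums_mult2) simp
    have sm: "summable (\<lambda>k. prob (B k))"
      by (rule summable_comparison_test'[OF sums_summable[OF geo]]) (use PB in auto)
    have "prob (\<Union>k. B k) \<le> (\<Sum>k. prob (B k))"
      using B sm by (intro finite_measure_subadditive_countably) auto
    also have "\<dots> \<le> (\<Sum>k. (1 / 2) ^ k * (1 / 4))"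
      by (intro suminf_le PB sm sums_summable[OF geo])
    also have "\<dots> = 1 / 2" using sums_unique[OF geo] by simp
    finally have half: "prob (\<Union>k. B k) \<le> 1 / 2" .
    have "space (perc p) - (\<Union>k. B k) \<subseteq> infinite_event p"
    proof
      fix \<omega> assume \<omega>: "\<omega> \<in> space (perc p) - (\<Union>k. B k)"
      have OV: "open_vertices V \<omega> \<subseteq> V" by (auto simp: open_vertices_def)
      have good: "good (L k) (open_vertices V \<omega>) y" if "y \<in> gball x (17 * L (Suc k))" for k y
        using \<omega> that unfolding B_def bad_event_def by blast
      have pow': "2 ^ k \<le> L k" for k
      proof -
        have "(2::nat) ^ k \<le> 2 ^ (k + 2)" by (intro power_increasing) auto
        then show ?thesis using pow[of k] by linarith
      qed
      from infinite_linked_of_good[where L = L, OF x OV pow' mono(2) good]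
      obtain u where u: "infinite {w. linked (open_vertices V \<omega>) u w}" by blast
      have "u \<in> V"
      proof (rule ccontr)
        assume "u \<notin> V"
        then have "{w. linked (open_vertices V \<omega>) u w} = {}" using linked_in OV by blast
        with u show False by simp
      qed
      with u \<omega> show "\<omega> \<in> infinite_event p"
        unfolding infinite_event_def infinite_cluster_iff by blast
    qed
    then have "prob (space (perc p) - (\<Union>k. B k)) \<le> prob (infinite_event p)"
      by (intro finite_measure_mono infinite_event_measurable)
    moreover have "prob (space (perc p) - (\<Union>k. B k)) = 1 - prob (\<Union>k. B k)"
      using B by (intro prob_compl) auto
    ultimately show ?thesis using half by auto
  qed
  moreover have "0 \<le> p0" "p0 < 1" unfolding p0_def using v eps by auto
  ultimately show ?thesis by blast
qed

lemma critical_probability_less_1: "critical_probability V E < 1"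
proof -
  obtain p0 where p0: "0 \<le> p0" "p0 < 1"
    "\<And>p. p0 \<le> p \<Longrightarrow> p \<le> 1 \<Longrightarrow> measure (perc p) (infinite_event p) \<noteq> 0"
    using ex_supercritical by blast
  have "Sup {p \<in> {0..1}. measure (perc p) (infinite_event p) = 0} \<le> p0"
  proof (rule cSup_least)
    show "{p \<in> {0..1}. measure (perc p) (infinite_event p) = 0} \<noteq> {}"
      using infinite_event_0 by (auto intro!: exI[of _ "0 :: real"])
    show "p \<le> p0" if "p \<in> {p \<in> {0..1}. measure (perc p) (infinite_event p) = 0}" for p
      using p0(3)[of p] that by force
  qed
  then show ?thesis using p0(2) unfolding critical_probability_eq by simp
qed

end

section \<open>From the growth hypothesis to the locale assumptions\<close>

theorem corollary1p11:
  fixes V :: "'v set" and E :: "'v set set" and c' c'' d' d'' :: real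
  assumes "simple_graph V E" and "connected_graph V E" and "vertex_transitive V E"
    and "c' > 0" and "c'' > 0" and "1 < d'" and "d' \<le> d''"
    and "\<And>v r. v \<in> V \<Longrightarrow> r \<ge> 1 \<Longrightarrow> finite (graph_ball V E v r) \<and>
           c' * real r powr d' \<le> real (card (graph_ball V E v r)) \<and>
           real (card (graph_ball V E v r)) \<le> c'' * real r powr d''"
  shows "critical_probability V E < 1"
proof -
  interpret connected_simple_graph V E
    using assms(1,2) by unfold_locales
  \<comment> \<open>The hypothesis covers radii from 1 on; passing to \<open>Suc r\<close> includes
    radius 0.\<close>
  have finite_balls: "finite (gball v r)" if "v \<in> V" for v r
    using assms(8)[OF that, of "Suc r"] finite_subset[OF ball_mono[of r "Suc r" v]] by simp
  \<comment> \<open>The lower bound is at least linear in the radius, hence exceeds any fixed number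
    of vertices.\<close>
  have "infinite V"
  proof
    assume fin: "finite V"
    obtain x where x: "x \<in> V" using assms(2) by (auto simp: connected_graph_def)
    obtain r :: nat where r: "real (card V) / c' < real r" using reals_Archimedean2 by blast
    define s where "s = Suc r"
    have "real (card V) < c' * real s" using r assms(4) unfolding s_def by (simp add: pos_divide_less_eq algebra_simps)
    also have "\<dots> \<le> c' * real s powr d'"
      using assms(4,6) powr_mono[of 1 d' "real s"] unfolding s_def by simp
    also have "\<dots> \<le> real (card (gball x s))" using assms(8)[OF x, of s] unfolding s_def by simp
    also have "\<dots> \<le> real (card V)" using card_mono[OF fin ball_subset_verts] by simp
    finally show False by simp
  qed
  then interpret transitive_graph V E
    using assms(3) finite_balls by unfold_locales
  obtain x where x: "x \<in> V" using verts_nonempty by auto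
  \<comment> \<open>Rounding up gives a polynomial upper bound in natural numbers.\<close>
  define A e where "A = nat \<lceil>c''\<rceil>" and "e = nat \<lceil>d''\<rceil>"
  interpret growing_graph V E c' d' A e
  proof
    show "0 < c'" "1 < d'" using assms by auto
    show "0 < e" unfolding e_def using assms(6,7) by simp
    show "c' * real r powr d' \<le> real (vol r)" if "1 \<le> r" for r
      using assms(8)[OF x that] card_ball[OF x] by simp
    show "vol r \<le> A * r ^ e" if "1 \<le> r" for r
    proof -
      have "real (vol r) \<le> c'' * real r powr d''" using assms(8)[OF x that] card_ball[OF x] by simp
      also have "\<dots> \<le> real A * real r powr real e"
        using that assms(5) unfolding A_def e_def
        by (intro mult_mono powr_mono) (auto simp: real_nat_ceiling_ge)
      also have "\<dots> = real (A * r ^ e)" using that by (simp add: powr_realpow)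
      finally show ?thesis by (simp only: of_nat_le_iff)
    qed
  qed
  show ?thesis by (rule critical_probability_less_1)
qed

end
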